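(* For a given function $\rho$, let $(\hat L_{ab},\ e_a{}^\mu,\ \Gamma_a{}^c{}_b,\ \hat C^d{}_{abc})$ be a solution to the equations $$\nabla^aT_{ab}=0,\qquad \Sigma_a{}^e{}_b=0,\qquad \Delta^d{}_{abc}=0,\qquad F_{bcd}=0$$ for which the metric compatibility condition $\Gamma_a{}^b{}_c\eta_{bd}+\Gamma_a{}^b{}_d\eta_{bc}=0$ holds. Then this solution implies the existence of a Lorentzian metric $g$ (namely $g=\eta_{ab}\,\omega^a\otimes\omega^b$ with $\{\omega^a\}$ the coframe dual to $\{e_a\}$) which is a solution to the Einstein field equations $$R_{ab}-\tfrac12\eta_{ab}R=\kappa T_{ab}$$ (in components with respect to the $g$-orthonormal frame $\{e_a\}$) with energy-momentum tensor defined by the components $T_{ab}$. Moreover, the fields $\hat C^d{}_{abc}$ are the components of the Weyl tensor of $g$.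
   Context: Frame indices $a,b,c,\dots$ range over $\{0,1,2,3\}$ and are moved with $\eta_{ab}=\mathrm{diag}(-1,1,1,1)$; $[\,]$ denotes antisymmetrisation with weight $\frac12$. $e_a=e_a{}^\mu\partial_\mu$ is a frame (four linearly independent vector fields) on a 4-manifold, $\partial_a:=e_a{}^\mu\partial_\mu$, and $\nabla$ is the connection defined by $\nabla_ae_b=\Gamma_a{}^c{}_be_c$. The energy-momentum tensor is $T_{ab}=\rho u_au_b+\Pi_{ab}$, where $u=e_0$, $\rho>0$, $\Pi_{ab}$ is symmetric and $\Pi_{ab}u^a=0$; $T=T^a{}_a$; $\kappa$ is the gravitational coupling constant. Define $$\hat L_{ab}=\frac{\kappa}{2}\Big(T_{ab}-\frac13\eta_{ab}T\Big).$$ $\hat C^d{}_{abc}$ are fields with the same algebraic symmetries as a Weyl tensor (including trace-freeness). The torsion is given by $$\Sigma_a{}^c{}_b\,e_c=[e_a,e_b]-(\Gamma_a{}^c{}_b-\Gamma_b{}^c{}_a)e_c,$$ and $\hat R^c{}_{dab}$ denotes the expression for the curvature in terms of the connection coefficients, $$\hat R^c{}_{dab}=\partial_a\Gamma_b{}^c{}_d-\partial_b\Gamma_a{}^c{}_d+\Gamma_f{}^c{}_d(\Gamma_b{}^f{}_a-\Gamma_a{}^f{}_b)+\Gamma_b{}^f{}_d\Gamma_a{}^c{}_f-\Gamma_a{}^f{}_d\Gamma_b{}^c{}_f-\Sigma_a{}^f{}_b\Gamma_f{}^c{}_d .$$ The remaining zero-quantities are $$\Delta^d{}_{abc}=\hat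 R^d{}_{abc}-\rho^d{}_{abc},\qquad \rho^d{}_{abc}=\hat C^d{}_{abc}+2\delta^d{}_{[b}\hat L_{c]a}-2\eta_{a[b}\hat L_{c]}{}^d,$$ $$F_{bcd}=\nabla_aF^a{}_{bcd},\qquad F^c{}_{abd}=\hat C^c{}_{abd}-2\delta^c{}_{[b}\hat L_{d]a}.$$ The Ricci tensor is $R_{ab}=R^c{}_{acb}$ and $R=R^a{}_a$; the Riemann tensor of $g$ decomposes as $R^c{}_{dab}=C^c{}_{dab}+2(\delta^c{}_{[a}L_{b]d}-\eta_{d[a}L_{b]}{}^c)$ with $C$ the Weyl tensor and $L_{ab}=\frac12(R_{ab}-\frac16R\eta_{ab})$ the Schouten tensor. *)

theory Defs
  imports "HOL-Analysis.Analysis"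
begin

section \<open>Smooth 4-manifolds and fields in charts\<close>

text \<open>
  All indices, frame and coordinate, have the four-element type \<open>4\<close>, whose elements are
  \<open>0, 1, 2, 3\<close>. (The library writes \<open>UNIV :: 4 set\<close> as \<open>{1, 2, 3, 4}\<close>, with \<open>4 = 0\<close>.)
\<close>

definition partial :: "4 \<Rightarrow> (real^4 \<Rightarrow> real) \<Rightarrow> real^4 \<Rightarrow> real" where
  "partial \<mu> f x = frechet_derivative f (at x) (axis \<mu> 1)"

text \<open>To be used on open sets only.\<close>

primrec Ck_on :: "nat \<Rightarrow> (real^4 \<Rightarrow> real) \<Rightarrow> (real^4) set \<Rightarrow> bool" where
  "Ck_on 0 f S \<longleftrightarrow> continuous_on S f"
| "Ck_on (Suc k) f S \<longleftrightarrow> (\<forall>x\<in>S. f differentiable (at x)) \<and> (\<forall>\<mu>. Ck_on k (partial \<mu> f) S)"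

definition smooth_on :: "(real^4 \<Rightarrow> real) \<Rightarrow> (real^4) set \<Rightarrow> bool" where
  "smooth_on f S \<longleftrightarrow> (\<forall>k. Ck_on k f S)"

text \<open>A chart is a pair of its domain and its coordinate map.\<close>

type_synonym 'm chart = "'m set \<times> ('m \<Rightarrow> real^4)"

definition smooth_in :: "'m chart \<Rightarrow> ('m \<Rightarrow> real) \<Rightarrow> bool" where
  "smooth_in K f \<longleftrightarrow> smooth_on (f \<circ> inv_into (fst K) (snd K)) (snd K ` fst K)"

definition smooth_manifold4 :: "'m topology \<Rightarrow> 'm chart set \<Rightarrow> bool" where
  "smooth_manifold4 X A \<longleftrightarrow>
     Hausdorff_space X \<and> second_countable X \<and> (\<Union>K\<in>A. fst K) = topspace X \<and>
     (\<forall>(U, \<phi>)\<in>A. openin X U \<and> open (\<phi> ` U) \<and>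
        homeomorphic_map (subtopology X U) (top_of_set (\<phi> ` U)) \<phi>) \<and>
     (\<forall>(U, \<phi>)\<in>A. \<forall>(V, \<psi>)\<in>A. \<forall>\<mu>.
        smooth_on (\<lambda>x. \<psi> (inv_into U \<phi> x) $ \<mu>) (\<phi> ` (U \<inter> V)))"

definition smooth_scalar :: "'m chart set \<Rightarrow> ('m \<Rightarrow> real) \<Rightarrow> bool" where
  "smooth_scalar A f \<longleftrightarrow> (\<forall>K\<in>A. smooth_in K f)"

text \<open>The coordinate derivative of a scalar along \<open>x\<^sup>\<mu>\<close> in the chart \<open>K\<close>.\<close>

definition coord_deriv :: "'m chart \<Rightarrow> 4 \<Rightarrow> ('m \<Rightarrow> real) \<Rightarrow> 'm \<Rightarrow> real" where
  "coord_deriv K \<mu> f p = partial \<mu> (f \<circ> inv_into (fst K) (snd K)) (snd K p)"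

text \<open>
  Vector fields and metrics are given by their components in every chart, subject to the
  transformation law on overlaps. Component values at points outside the domain of the chart
  carry no meaning.
\<close>

type_synonym 'm vecfield = "'m chart \<Rightarrow> 'm \<Rightarrow> real^4"

type_synonym 'm metric_tensor = "'m chart \<Rightarrow> 'm \<Rightarrow> real^4^4"

definition vector_field :: "'m chart set \<Rightarrow> 'm vecfield \<Rightarrow> bool" where
  "vector_field A V \<longleftrightarrow>
     (\<forall>K\<in>A. \<forall>\<mu>. smooth_in K (\<lambda>p. V K p $ \<mu>)) \<and>
     (\<forall>K\<in>A. \<forall>K'\<in>A. \<forall>p \<in> fst K \<inter> fst K'. \<forall>\<nu>.
        V K' p $ \<nu> = (\<Sum>\<mu>\<in>UNIV. coord_deriv K \<mu> (\<lambda>q. snd K' q $ \<nu>) p * V K p $ \<mu>))"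

definition lie_bracket :: "'m vecfield \<Rightarrow> 'm vecfield \<Rightarrow> 'm vecfield" where
  "lie_bracket V W K p =
     (\<chi> \<mu>. \<Sum>\<nu>\<in>UNIV. V K p $ \<nu> * coord_deriv K \<nu> (\<lambda>q. W K q $ \<mu>) p
                   - W K p $ \<nu> * coord_deriv K \<nu> (\<lambda>q. V K q $ \<mu>) p)"

definition eta :: "4 \<Rightarrow> 4 \<Rightarrow> real" where
  "eta a b = (if a = b then if a = 0 then -1 else 1 else 0)"

definition delta :: "4 \<Rightarrow> 4 \<Rightarrow> real" where
  "delta a b = (if a = b then 1 else 0)"

definition asym :: "(4 \<Rightarrow> 4 \<Rightarrow> real) \<Rightarrow> 4 \<Rightarrow> 4 \<Rightarrow> real" where
  "asym t a b = (t a b - t b a) / 2"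

definition lorentzian_metric :: "'m chart set \<Rightarrow> 'm metric_tensor \<Rightarrow> bool" where
  "lorentzian_metric A g \<longleftrightarrow>
     (\<forall>K\<in>A. \<forall>\<mu> \<nu>. smooth_in K (\<lambda>p. g K p $ \<mu> $ \<nu>)) \<and>
     (\<forall>K\<in>A. \<forall>K'\<in>A. \<forall>p \<in> fst K \<inter> fst K'. \<forall>\<mu> \<nu>.
        g K' p $ \<mu> $ \<nu> =
          (\<Sum>\<alpha>\<in>UNIV. \<Sum>\<beta>\<in>UNIV. coord_deriv K' \<mu> (\<lambda>q. snd K q $ \<alpha>) p *
             coord_deriv K' \<nu> (\<lambda>q. snd K q $ \<beta>) p * g K p $ \<alpha> $ \<beta>)) \<and>
     (\<forall>K\<in>A. \<forall>p \<in> fst K. transpose (g K p) = g K p \<and>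
        (\<exists>P. invertible P \<and> transpose P ** g K p ** P = (\<chi> a b. eta a b)))"


section \<open>Curvature of a metric in coordinates\<close>

text \<open>
  With the Levi-Civita connection and the sign convention
  \<open>R(\<partial>\<^sub>\<mu>, \<partial>\<^sub>\<nu>) \<partial>\<^sub>\<sigma> = R\<^sup>\<tau>\<^sub>\<sigma>\<^sub>\<mu>\<^sub>\<nu> \<partial>\<^sub>\<tau>\<close>; the argument order is \<open>riemann g K \<tau> \<sigma> \<mu> \<nu>\<close>.
\<close>

definition inv_metric :: "'m metric_tensor \<Rightarrow> 'm chart \<Rightarrow> 4 \<Rightarrow> 4 \<Rightarrow> 'm \<Rightarrow> real" where
  "inv_metric g K \<mu> \<nu> p = matrix_inv (g K p) $ \<mu> $ \<nu>"

definition christoffel :: "'m metric_tensor \<Rightarrow> 'm chart \<Rightarrow> 4 \<Rightarrow> 4 \<Rightarrow> 4 \<Rightarrow> 'm \<Rightarrow> real" where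
  "christoffel g K \<tau> \<mu> \<nu> p =
     1/2 * (\<Sum>\<sigma>\<in>UNIV. inv_metric g K \<tau> \<sigma> p *
       (coord_deriv K \<mu> (\<lambda>q. g K q $ \<sigma> $ \<nu>) p + coord_deriv K \<nu> (\<lambda>q. g K q $ \<sigma> $ \<mu>) p
        - coord_deriv K \<sigma> (\<lambda>q. g K q $ \<mu> $ \<nu>) p))"

definition riemann :: "'m metric_tensor \<Rightarrow> 'm chart \<Rightarrow> 4 \<Rightarrow> 4 \<Rightarrow> 4 \<Rightarrow> 4 \<Rightarrow> 'm \<Rightarrow> real" where
  "riemann g K \<tau> \<sigma> \<mu> \<nu> p =
     coord_deriv K \<mu> (christoffel g K \<tau> \<nu> \<sigma>) p - coord_deriv K \<nu> (christoffel g K \<tau> \<mu> \<sigma>) p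
     + (\<Sum>\<kappa>\<in>UNIV. christoffel g K \<tau> \<mu> \<kappa> p * christoffel g K \<kappa> \<nu> \<sigma> p
                 - christoffel g K \<tau> \<nu> \<kappa> p * christoffel g K \<kappa> \<mu> \<sigma> p)"

definition ricci :: "'m metric_tensor \<Rightarrow> 'm chart \<Rightarrow> 4 \<Rightarrow> 4 \<Rightarrow> 'm \<Rightarrow> real" where
  "ricci g K \<mu> \<nu> p = (\<Sum>\<tau>\<in>UNIV. riemann g K \<tau> \<mu> \<tau> \<nu> p)"

definition scalar_curv :: "'m metric_tensor \<Rightarrow> 'm chart \<Rightarrow> 'm \<Rightarrow> real" where
  "scalar_curv g K p = (\<Sum>\<mu>\<in>UNIV. \<Sum>\<nu>\<in>UNIV. inv_metric g K \<mu> \<nu> p * ricci g K \<mu> \<nu> p)"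

definition schouten :: "'m metric_tensor \<Rightarrow> 'm chart \<Rightarrow> 4 \<Rightarrow> 4 \<Rightarrow> 'm \<Rightarrow> real" where
  "schouten g K \<mu> \<nu> p =
     1/2 * (ricci g K \<mu> \<nu> p - 1/6 * scalar_curv g K p * g K p $ \<mu> $ \<nu>)"

definition schouten_up :: "'m metric_tensor \<Rightarrow> 'm chart \<Rightarrow> 4 \<Rightarrow> 4 \<Rightarrow> 'm \<Rightarrow> real" where
  "schouten_up g K \<mu> \<tau> p = (\<Sum>\<sigma>\<in>UNIV. schouten g K \<mu> \<sigma> p * inv_metric g K \<sigma> \<tau> p)"

definition weyl :: "'m metric_tensor \<Rightarrow> 'm chart \<Rightarrow> 4 \<Rightarrow> 4 \<Rightarrow> 4 \<Rightarrow> 4 \<Rightarrow> 'm \<Rightarrow> real" where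
  "weyl g K \<tau> \<sigma> \<mu> \<nu> p = riemann g K \<tau> \<sigma> \<mu> \<nu> p
     - 2 * (asym (\<lambda>\<mu> \<nu>. delta \<tau> \<mu> * schouten g K \<nu> \<sigma> p) \<mu> \<nu>
            - asym (\<lambda>\<mu> \<nu>. g K p $ \<sigma> $ \<mu> * schouten_up g K \<nu> \<tau> p) \<mu> \<nu>)"


section \<open>Frames\<close>

text \<open>A frame assigns to each index \<open>a\<close> the vector field \<open>e\<^sub>a\<close>; \<open>e a K p $ \<mu>\<close> is \<open>e\<^sub>a\<^sup>\<mu>\<close>.\<close>

type_synonym 'm frame = "4 \<Rightarrow> 'm vecfield"

definition is_frame :: "'m chart set \<Rightarrow> 'm frame \<Rightarrow> bool" where
  "is_frame A e \<longleftrightarrow> (\<forall>a. vector_field A (e a)) \<and>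
     (\<forall>K\<in>A. \<forall>p \<in> fst K. inj (\<lambda>a. e a K p) \<and> independent (range (\<lambda>a. e a K p)))"

text \<open>
  The dual coframe \<open>\<omega>\<^sup>a\<^sub>\<mu>\<close>: the inverse of the matrix whose column number \<open>a\<close> is \<open>e\<^sub>a\<close>.
\<close>

definition coframe :: "'m frame \<Rightarrow> 'm chart \<Rightarrow> 4 \<Rightarrow> 4 \<Rightarrow> 'm \<Rightarrow> real" where
  "coframe e K a \<mu> p = matrix_inv (\<chi> \<nu> b. e b K p $ \<nu>) $ a $ \<mu>"

definition coframe_metric :: "'m frame \<Rightarrow> 'm metric_tensor" where
  "coframe_metric e K p =
     (\<chi> \<mu> \<nu>. \<Sum>a\<in>UNIV. \<Sum>b\<in>UNIV. eta a b * coframe e K a \<mu> p * coframe e K b \<nu> p)"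

definition frame_deriv :: "'m frame \<Rightarrow> 'm chart \<Rightarrow> 4 \<Rightarrow> ('m \<Rightarrow> real) \<Rightarrow> 'm \<Rightarrow> real" where
  "frame_deriv e K a f p = (\<Sum>\<mu>\<in>UNIV. e a K p $ \<mu> * coord_deriv K \<mu> f p)"

definition frame_comp2 ::
    "'m frame \<Rightarrow> 'm chart \<Rightarrow> (4 \<Rightarrow> 4 \<Rightarrow> 'm \<Rightarrow> real) \<Rightarrow> 4 \<Rightarrow> 4 \<Rightarrow> 'm \<Rightarrow> real" where
  "frame_comp2 e K S a b p = (\<Sum>\<mu>\<in>UNIV. \<Sum>\<nu>\<in>UNIV. e a K p $ \<mu> * e b K p $ \<nu> * S \<mu> \<nu> p)"

definition frame_comp13 ::
    "'m frame \<Rightarrow> 'm chart \<Rightarrow> (4 \<Rightarrow> 4 \<Rightarrow> 4 \<Rightarrow> 4 \<Rightarrow> 'm \<Rightarrow> real) \<Rightarrow> 4 \<Rightarrow> 4 \<Rightarrow> 4 \<Rightarrow> 4 \<Rightarrow> 'm \<Rightarrow> real" where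
  "frame_comp13 e K S d a b c p =
     (\<Sum>\<tau>\<in>UNIV. \<Sum>\<sigma>\<in>UNIV. \<Sum>\<mu>\<in>UNIV. \<Sum>\<nu>\<in>UNIV.
        coframe e K d \<tau> p * e a K p $ \<sigma> * e b K p $ \<mu> * e c K p $ \<nu> * S \<tau> \<sigma> \<mu> \<nu> p)"


section \<open>Connection coefficients and zero-quantities\<close>

text \<open>
  Index order is that of the horizontal positions: \<open>\<Gamma> a c b\<close> is \<open>\<Gamma>\<^sub>a\<^sup>c\<^sub>b\<close>, where
  \<open>\<nabla>\<^sub>a e\<^sub>b = \<Gamma>\<^sub>a\<^sup>c\<^sub>b e\<^sub>c\<close>. The connection coefficients are scalars on the manifold.
\<close>

type_synonym 'm conn = "4 \<Rightarrow> 4 \<Rightarrow> 4 \<Rightarrow> 'm \<Rightarrow> real"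

definition metric_compatible :: "'m conn \<Rightarrow> 'm \<Rightarrow> bool" where
  "metric_compatible \<Gamma> p \<longleftrightarrow>
     (\<forall>a c d. (\<Sum>b\<in>UNIV. \<Gamma> a b c p * eta b d) + (\<Sum>b\<in>UNIV. \<Gamma> a b d p * eta b c) = 0)"

definition nabla2 ::
    "'m frame \<Rightarrow> 'm conn \<Rightarrow> 'm chart \<Rightarrow> 4 \<Rightarrow> (4 \<Rightarrow> 4 \<Rightarrow> 'm \<Rightarrow> real) \<Rightarrow> 4 \<Rightarrow> 4 \<Rightarrow> 'm \<Rightarrow> real" where
  "nabla2 e \<Gamma> K a T b c p = frame_deriv e K a (T b c) p
     - (\<Sum>f\<in>UNIV. \<Gamma> a f b p * T f c p) - (\<Sum>f\<in>UNIV. \<Gamma> a f c p * T b f p)"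

definition nabla13 ::
    "'m frame \<Rightarrow> 'm conn \<Rightarrow> 'm chart \<Rightarrow> 4 \<Rightarrow> (4 \<Rightarrow> 4 \<Rightarrow> 4 \<Rightarrow> 4 \<Rightarrow> 'm \<Rightarrow> real) \<Rightarrow>
      4 \<Rightarrow> 4 \<Rightarrow> 4 \<Rightarrow> 4 \<Rightarrow> 'm \<Rightarrow> real" where
  "nabla13 e \<Gamma> K a F h b c d p = frame_deriv e K a (F h b c d) p
     + (\<Sum>f\<in>UNIV. \<Gamma> a h f p * F f b c d p)
     - (\<Sum>f\<in>UNIV. \<Gamma> a f b p * F h f c d p)
     - (\<Sum>f\<in>UNIV. \<Gamma> a f c p * F h b f d p)
     - (\<Sum>f\<in>UNIV. \<Gamma> a f d p * F h b c f p)"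

text \<open>Contraction of the bracket with the coframe solves the defining relation of the torsion.\<close>

definition torsion :: "'m frame \<Rightarrow> 'm conn \<Rightarrow> 'm chart \<Rightarrow> 4 \<Rightarrow> 4 \<Rightarrow> 4 \<Rightarrow> 'm \<Rightarrow> real" where
  "torsion e \<Gamma> K a c b p =
     (\<Sum>\<mu>\<in>UNIV. coframe e K c \<mu> p * lie_bracket (e a) (e b) K p $ \<mu>) - (\<Gamma> a c b p - \<Gamma> b c a p)"

definition curv_hat :: "'m frame \<Rightarrow> 'm conn \<Rightarrow> 'm chart \<Rightarrow> 4 \<Rightarrow> 4 \<Rightarrow> 4 \<Rightarrow> 4 \<Rightarrow> 'm \<Rightarrow> real" where
  "curv_hat e \<Gamma> K c d a b p =
     frame_deriv e K a (\<Gamma> b c d) p - frame_deriv e K b (\<Gamma> a c d) p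
     + (\<Sum>f\<in>UNIV. \<Gamma> f c d p * (\<Gamma> b f a p - \<Gamma> a f b p))
     + (\<Sum>f\<in>UNIV. \<Gamma> b f d p * \<Gamma> a c f p) - (\<Sum>f\<in>UNIV. \<Gamma> a f d p * \<Gamma> b c f p)
     - (\<Sum>f\<in>UNIV. torsion e \<Gamma> K a f b p * \<Gamma> f c d p)"

text \<open>Since \<open>u = e\<^sub>0\<close>, its frame components are \<open>\<delta>\<^sub>0\<^sup>a\<close>. The tensor \<open>\<Pi>\<^sub>a\<^sub>b\<close> is written \<open>P a b\<close>.\<close>

definition u_up :: "4 \<Rightarrow> real" where
  "u_up a = delta 0 a"

definition u_down :: "4 \<Rightarrow> real" where
  "u_down a = (\<Sum>b\<in>UNIV. eta a b * u_up b)"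

definition emt :: "('m \<Rightarrow> real) \<Rightarrow> (4 \<Rightarrow> 4 \<Rightarrow> 'm \<Rightarrow> real) \<Rightarrow> 4 \<Rightarrow> 4 \<Rightarrow> 'm \<Rightarrow> real" where
  "emt \<rho> P a b p = \<rho> p * u_down a * u_down b + P a b p"

text \<open>Below, \<open>eta\<close> also serves as its own inverse \<open>\<eta>\<^sup>a\<^sup>b\<close>.\<close>

definition eta_trace :: "(4 \<Rightarrow> 4 \<Rightarrow> 'm \<Rightarrow> real) \<Rightarrow> 'm \<Rightarrow> real" where
  "eta_trace T p = (\<Sum>a\<in>UNIV. \<Sum>b\<in>UNIV. eta a b * T a b p)"

definition L_hat :: "real \<Rightarrow> (4 \<Rightarrow> 4 \<Rightarrow> 'm \<Rightarrow> real) \<Rightarrow> 4 \<Rightarrow> 4 \<Rightarrow> 'm \<Rightarrow> real" where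
  "L_hat \<kappa> T a b p = \<kappa> / 2 * (T a b p - 1/3 * eta a b * eta_trace T p)"

definition raise2 :: "(4 \<Rightarrow> 4 \<Rightarrow> 'm \<Rightarrow> real) \<Rightarrow> 4 \<Rightarrow> 4 \<Rightarrow> 'm \<Rightarrow> real" where
  "raise2 L c d p = (\<Sum>f\<in>UNIV. L c f p * eta f d)"

definition lower1 :: "(4 \<Rightarrow> 4 \<Rightarrow> 4 \<Rightarrow> 4 \<Rightarrow> 'm \<Rightarrow> real) \<Rightarrow> 4 \<Rightarrow> 4 \<Rightarrow> 4 \<Rightarrow> 4 \<Rightarrow> 'm \<Rightarrow> real" where
  "lower1 C d a b c p = (\<Sum>f\<in>UNIV. eta d f * C f a b c p)"

definition weyl_symmetries :: "(4 \<Rightarrow> 4 \<Rightarrow> 4 \<Rightarrow> 4 \<Rightarrow> 'm \<Rightarrow> real) \<Rightarrow> 'm \<Rightarrow> bool" where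
  "weyl_symmetries C p \<longleftrightarrow>
     (\<forall>d a b c. lower1 C d a b c p = - lower1 C a d b c p) \<and>
     (\<forall>d a b c. lower1 C d a b c p = - lower1 C d a c b p) \<and>
     (\<forall>d a b c. lower1 C d a b c p = lower1 C b c d a p) \<and>
     (\<forall>d a b c. lower1 C d a b c p + lower1 C d b c a p + lower1 C d c a b p = 0) \<and>
     (\<forall>a b. (\<Sum>c\<in>UNIV. C c a c b p) = 0)"

definition rho_curv ::
    "(4 \<Rightarrow> 4 \<Rightarrow> 'm \<Rightarrow> real) \<Rightarrow> (4 \<Rightarrow> 4 \<Rightarrow> 4 \<Rightarrow> 4 \<Rightarrow> 'm \<Rightarrow> real) \<Rightarrow>
      4 \<Rightarrow> 4 \<Rightarrow> 4 \<Rightarrow> 4 \<Rightarrow> 'm \<Rightarrow> real" where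
  "rho_curv L C d a b c p = C d a b c p
     + 2 * asym (\<lambda>b c. delta d b * L c a p) b c
     - 2 * asym (\<lambda>b c. eta a b * raise2 L c d p) b c"

definition Delta_zero ::
    "'m frame \<Rightarrow> 'm conn \<Rightarrow> (4 \<Rightarrow> 4 \<Rightarrow> 'm \<Rightarrow> real) \<Rightarrow> (4 \<Rightarrow> 4 \<Rightarrow> 4 \<Rightarrow> 4 \<Rightarrow> 'm \<Rightarrow> real) \<Rightarrow>
      'm chart \<Rightarrow> 4 \<Rightarrow> 4 \<Rightarrow> 4 \<Rightarrow> 4 \<Rightarrow> 'm \<Rightarrow> real" where
  "Delta_zero e \<Gamma> L C K d a b c p = curv_hat e \<Gamma> K d a b c p - rho_curv L C d a b c p"

definition F_up ::
    "(4 \<Rightarrow> 4 \<Rightarrow> 'm \<Rightarrow> real) \<Rightarrow> (4 \<Rightarrow> 4 \<Rightarrow> 4 \<Rightarrow> 4 \<Rightarrow> 'm \<Rightarrow> real) \<Rightarrow>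
      4 \<Rightarrow> 4 \<Rightarrow> 4 \<Rightarrow> 4 \<Rightarrow> 'm \<Rightarrow> real" where
  "F_up L C c a b d p = C c a b d p - 2 * asym (\<lambda>b d. delta c b * L d a p) b d"

definition F_zero ::
    "'m frame \<Rightarrow> 'm conn \<Rightarrow> (4 \<Rightarrow> 4 \<Rightarrow> 'm \<Rightarrow> real) \<Rightarrow> (4 \<Rightarrow> 4 \<Rightarrow> 4 \<Rightarrow> 4 \<Rightarrow> 'm \<Rightarrow> real) \<Rightarrow>
      'm chart \<Rightarrow> 4 \<Rightarrow> 4 \<Rightarrow> 4 \<Rightarrow> 'm \<Rightarrow> real" where
  "F_zero e \<Gamma> L C K b c d p = (\<Sum>a\<in>UNIV. nabla13 e \<Gamma> K a (F_up L C) a b c d p)"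

definition div_emt ::
    "'m frame \<Rightarrow> 'm conn \<Rightarrow> (4 \<Rightarrow> 4 \<Rightarrow> 'm \<Rightarrow> real) \<Rightarrow> 'm chart \<Rightarrow> 4 \<Rightarrow> 'm \<Rightarrow> real" where
  "div_emt e \<Gamma> T K b p = (\<Sum>a\<in>UNIV. \<Sum>c\<in>UNIV. eta a c * nabla2 e \<Gamma> K c T a b p)"

end

theory Submission
  imports Defs
begin

text \<open>
  Read in the coordinate basis, the connection \<open>\<Gamma>\<close> compatible with \<open>\<eta>\<close> and free of torsion is
  compatible with \<open>g = \<eta>\<^sub>a\<^sub>b \<omega>\<^sup>a \<otimes> \<omega>\<^sup>b\<close> and symmetric, hence given by the Christoffel symbols of \<open>g\<close>.
  Its curvature expression is therefore the Riemann tensor of \<open>g\<close> in the frame, so that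
  \<open>\<Delta> = 0\<close> prescribes this tensor to be \<open>\<rho>\<^sup>d\<^sub>a\<^sub>b\<^sub>c\<close>. Since \<open>C\<close> is trace-free, contraction gives
  \<open>R\<^sub>a\<^sub>b = 2 L\<^sub>a\<^sub>b + \<eta>\<^sub>a\<^sub>b L\<^sup>c\<^sub>c = \<kappa> (T\<^sub>a\<^sub>b - \<eta>\<^sub>a\<^sub>b T\<^sup>c\<^sub>c / 2)\<close>. Thus Einstein's equations hold, \<open>L\<close> is the Schouten
  tensor of \<open>g\<close>, and what remains of \<open>\<rho>\<^sup>d\<^sub>a\<^sub>b\<^sub>c\<close> is the Weyl tensor.
\<close>

section \<open>Differentiability of order k and symmetry of second derivatives\<close>

lemma partial_const: "partial \<mu> (\<lambda>x. c) x = 0"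
  by (simp add: partial_def)

lemma partial_eqI: "(f has_derivative f') (at x) \<Longrightarrow> partial \<mu> f x = f' (axis \<mu> 1)"
  unfolding partial_def using frechet_derivative_at by metis

lemma has_derivative_partialD:
  assumes "f differentiable (at x)"
  shows "(f has_derivative frechet_derivative f (at x)) (at x)"
  using assms frechet_derivative_works by blast

lemma partial_add:
  assumes "f differentiable (at x)" "g differentiable (at x)"
  shows "partial \<mu> (\<lambda>x. f x + g x) x = partial \<mu> f x + partial \<mu> g x"
  using partial_eqI[OF has_derivative_add[OF assms[THEN has_derivative_partialD]]]
  by (simp add: partial_def)

lemma partial_mult:
  assumes "f differentiable (at x)" "g differentiable (at x)"
  shows "partial \<mu> (\<lambda>x. f x * g x) x = f x * partial \<mu> g x + partial \<mu> f x * g x"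
  using partial_eqI[OF has_derivative_mult[OF assms[THEN has_derivative_partialD]]]
  by (simp add: partial_def)

text \<open>The derivative is written with products and a constant factor only, so that
  \<open>Ck_on_mult\<close> and \<open>Ck_on_const\<close> apply to it directly in
  \<open>Ck_on_inverse\<close>.\<close>

lemma partial_inverse:
  assumes "f differentiable (at x)" "f x \<noteq> 0"
  shows "partial \<mu> (\<lambda>x. inverse (f x)) x = - 1 * (partial \<mu> f x * (inverse (f x) * inverse (f x)))"
  using partial_eqI[OF Deriv.has_derivative_inverse[OF assms(2) has_derivative_partialD[OF assms(1)]]]
  by (simp add: partial_def mult_ac)

lemma partial_transform_open:
  assumes "f differentiable (at x)" "open S" "x \<in> S" "\<And>y. y \<in> S \<Longrightarrow> f y = g y"
  shows "partial \<mu> f x = partial \<mu> g x"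
  unfolding partial_def using frechet_derivative_transform_within_open[OF assms] by simp

lemma differentiable_transform_open:
  assumes "f differentiable (at x)" "open S" "x \<in> S" "\<And>y. y \<in> S \<Longrightarrow> f y = g y"
  shows "g differentiable (at x)"
  using assms has_derivative_transform_within_open unfolding differentiable_def by blast

section \<open>Closure properties of k times continuously differentiable functions\<close>

lemma Ck_on_cong:
  assumes "open S" "\<And>x. x \<in> S \<Longrightarrow> f x = g x" "Ck_on k f S"
  shows "Ck_on k g S"
  using assms(2,3)
proof (induction k arbitrary: f g)
  case 0
  then show ?case using continuous_on_cong[of S S f g] by simp
next
  case (Suc k)
  have "Ck_on k (partial \<mu> g) S" for \<mu>
  proof (rule Suc.IH)
    show "partial \<mu> f x = partial \<mu> g x" if "x \<in> S" for x
      using partial_transform_open[OF _ assms(1) that] Suc.prems that by simp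
  qed (use Suc.prems in simp)
  moreover have "g differentiable (at x)" if "x \<in> S" for x
    by (rule differentiable_transform_open[OF _ assms(1) that, of f]) (use Suc.prems that in auto)
  ultimately show ?case by simp
qed

text \<open>At order \<open>Suc k\<close>, \<open>Ck_on\<close> speaks of differentiability and of
  the partial derivatives only. Lowering the order is therefore an induction that starts from the
  continuity of differentiable functions.\<close>

lemma Ck_on_SucD: "Ck_on (Suc k) f S \<Longrightarrow> Ck_on k f S"
proof (induction k arbitrary: f)
  case 0
  then show ?case
    by (auto intro!: continuous_at_imp_continuous_on differentiable_imp_continuous_within)
qed auto

lemma Ck_on_const: "Ck_on k (\<lambda>x. c) S"
proof (induction k arbitrary: c)
  case (Suc k)
  have "partial \<mu> (\<lambda>x. c) = (\<lambda>x. 0)" for \<mu>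
    by (rule ext) (rule partial_const)
  then show ?case using Suc by simp
qed simp

text \<open>The rule for the derivative of a sum is known at points of \<open>S\<close> only, so
  \<open>Ck_on_cong\<close> carries the induction hypothesis over to the actual partial derivative.
  Products and inverses follow the same pattern.\<close>

lemma Ck_on_add:
  assumes "open S" "Ck_on k f S" "Ck_on k g S"
  shows "Ck_on k (\<lambda>x. f x + g x) S"
  using assms(2,3)
proof (induction k arbitrary: f g)
  case 0
  then show ?case by (auto intro: continuous_on_add)
next
  case (Suc k)
  have "Ck_on k (partial \<mu> (\<lambda>x. f x + g x)) S" for \<mu>
    by (rule Ck_on_cong[OF assms(1) _ Suc.IH[of "partial \<mu> f" "partial \<mu> g"]])
      (use Suc.prems partial_add in auto)
  then show ?case using Suc.prems by (auto intro: differentiable_add)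
qed

lemma Ck_on_mult:
  assumes "open S" "Ck_on k f S" "Ck_on k g S"
  shows "Ck_on k (\<lambda>x. f x * g x) S"
  using assms(2,3)
proof (induction k arbitrary: f g)
  case 0
  then show ?case by (auto intro: continuous_on_mult)
next
  case (Suc k)
  have "Ck_on k (partial \<mu> (\<lambda>x. f x * g x)) S" for \<mu>
  proof (rule Ck_on_cong[OF assms(1)])
    show "Ck_on k (\<lambda>x. f x * partial \<mu> g x + partial \<mu> f x * g x) S"
      using Suc.prems by (intro Ck_on_add Suc.IH assms(1)) (auto intro: Ck_on_SucD)
  qed (use Suc.prems partial_mult in auto)
  then show ?case using Suc.prems by (auto intro: differentiable_mult)
qed

text \<open>The induction closes because the derivative of 1/f is a polynomial in 1/f and the
  derivative of f, and 1/f is known to have the lower order.\<close>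

lemma Ck_on_inverse:
  assumes "open S" "\<And>x. x \<in> S \<Longrightarrow> f x \<noteq> 0" "Ck_on k f S"
  shows "Ck_on k (\<lambda>x. inverse (f x)) S"
  using assms(3)
proof (induction k)
  case 0
  then show ?case using assms(2) by (auto intro: continuous_on_inverse)
next
  case (Suc k)
  have inv: "Ck_on k (\<lambda>x. inverse (f x)) S" using Suc Ck_on_SucD by blast
  have "Ck_on k (partial \<mu> (\<lambda>x. inverse (f x))) S" for \<mu>
  proof (rule Ck_on_cong[OF assms(1)])
    show "Ck_on k (\<lambda>x. - 1 * (partial \<mu> f x * (inverse (f x) * inverse (f x)))) S"
      using Suc.prems inv by (intro Ck_on_mult Ck_on_const assms(1)) auto
  qed (use Suc.prems partial_inverse assms(2) in auto)
  then show ?case using Suc.prems assms(2) by (auto intro: differentiable_inverse)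
qed

section \<open>Mean value theorem along an axis and symmetry of second derivatives\<close>

lemma MVT_partial:
  fixes f :: "real^4 \<Rightarrow> real"
  assumes "t > 0"
    and "\<And>s. 0 \<le> s \<Longrightarrow> s \<le> t \<Longrightarrow> f differentiable (at (y + s *\<^sub>R axis \<mu> 1))"
  shows "\<exists>s. 0 < s \<and> s < t \<and>
    f (y + t *\<^sub>R axis \<mu> 1) - f y = t * partial \<mu> f (y + s *\<^sub>R axis \<mu> 1)"
proof -
  let ?u = "axis \<mu> (1::real)"
  have d: "((\<lambda>s. f (y + s *\<^sub>R ?u)) has_real_derivative partial \<mu> f (y + s *\<^sub>R ?u)) (at s)"
    if "0 \<le> s" "s \<le> t" for s
  proof -
    let ?f' = "frechet_derivative f (at (y + s *\<^sub>R ?u))"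
    have f': "(f has_derivative ?f') (at (y + s *\<^sub>R ?u))"
      using assms(2)[OF that] by (rule has_derivative_partialD)
    have "((\<lambda>s. y + s *\<^sub>R ?u) has_derivative (\<lambda>h. h *\<^sub>R ?u)) (at s)"
      by (auto intro!: derivative_eq_intros)
    from has_derivative_compose[OF this f']
    have "((\<lambda>s. f (y + s *\<^sub>R ?u)) has_derivative (\<lambda>h. ?f' (h *\<^sub>R ?u))) (at s)" .
    moreover have "(\<lambda>h. ?f' (h *\<^sub>R ?u)) = (*) (partial \<mu> f (y + s *\<^sub>R ?u))"
      using linear_scale[OF has_derivative_linear[OF f']] by (auto simp: partial_def)
    ultimately show ?thesis by (simp add: has_field_derivative_def)
  qed
  from MVT2[OF assms(1) d] obtain s where
    "0 < s" "s < t" "f (y + t *\<^sub>R ?u) - f (y + 0 *\<^sub>R ?u) = (t - 0) * partial \<mu> f (y + s *\<^sub>R ?u)"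
    by blast
  then show ?thesis by auto
qed

text \<open>The second difference is the increment along \<mu> of the first difference along \<nu>.
  The mean value theorem is applied once in each direction. The left-hand side is symmetric in \<mu>
  and \<nu> while the right-hand side fixes an order of differentiation, which is what
  \<open>partial_commute\<close> exploits.\<close>

lemma second_difference:
  fixes f :: "real^4 \<Rightarrow> real"
  assumes t: "t > 0" and in_S: "\<And>r s. 0 \<le> r \<Longrightarrow> r \<le> t \<Longrightarrow> 0 \<le> s \<Longrightarrow> s \<le> t \<Longrightarrow>
      y + r *\<^sub>R axis \<mu> 1 + s *\<^sub>R axis \<nu> 1 \<in> S"
    and "Ck_on 2 f S"
  shows "\<exists>r s. 0 < r \<and> r < t \<and> 0 < s \<and> s < t \<and>
    f (y + t *\<^sub>R axis \<mu> 1 + t *\<^sub>R axis \<nu> 1) - f (y + t *\<^sub>R axis \<mu> 1) - f (y + t *\<^sub>R axis \<nu> 1) + f y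
    = t * t * partial \<nu> (partial \<mu> f) (y + r *\<^sub>R axis \<mu> 1 + s *\<^sub>R axis \<nu> 1)"
proof -
  let ?u = "axis \<mu> (1::real)" and ?v = "axis \<nu> (1::real)"
  define \<phi> where "\<phi> z = f (z + t *\<^sub>R ?v) - f z" for z
  have fd: "f differentiable (at z)" "partial \<mu> f differentiable (at z)" if "z \<in> S" for z
    using assms(3) that by (auto simp: numeral_2_eq_2)
  have \<phi>: "\<phi> differentiable (at z)"
      "partial \<mu> \<phi> z = partial \<mu> f (z + t *\<^sub>R ?v) - partial \<mu> f z"
    if "z \<in> S" "z + t *\<^sub>R ?v \<in> S" for z
  proof -
    have "((\<lambda>z. z + t *\<^sub>R ?v) has_derivative (\<lambda>h. h)) (at z)"
      by (auto intro!: derivative_eq_intros)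
    from has_derivative_diff[OF has_derivative_compose[OF this
        has_derivative_partialD[OF fd(1)[OF that(2)]]] has_derivative_partialD[OF fd(1)[OF that(1)]]]
    have "(\<phi> has_derivative (\<lambda>h. frechet_derivative f (at (z + t *\<^sub>R ?v)) h
        - frechet_derivative f (at z) h)) (at z)"
      by (simp add: \<phi>_def[abs_def])
    from partial_eqI[OF this] this
    show "\<phi> differentiable (at z)"
      "partial \<mu> \<phi> z = partial \<mu> f (z + t *\<^sub>R ?v) - partial \<mu> f z"
      by (auto simp: partial_def differentiable_def)
  qed
  have S: "y + r *\<^sub>R ?u \<in> S" "y + r *\<^sub>R ?u + t *\<^sub>R ?v \<in> S" if "0 \<le> r" "r \<le> t" for r
    using in_S[OF that, of 0] in_S[OF that, of t] t by auto
  obtain r where r: "0 < r" "r < t" "\<phi> (y + t *\<^sub>R ?u) - \<phi> y = t * partial \<mu> \<phi> (y + r *\<^sub>R ?u)"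
    using MVT_partial[OF t, of \<phi> y \<mu>] \<phi>(1) S by blast
  obtain s where s: "0 < s" "s < t"
    "partial \<mu> f (y + r *\<^sub>R ?u + t *\<^sub>R ?v) - partial \<mu> f (y + r *\<^sub>R ?u)
      = t * partial \<nu> (partial \<mu> f) (y + r *\<^sub>R ?u + s *\<^sub>R ?v)"
    using MVT_partial[OF t, of "partial \<mu> f" "y + r *\<^sub>R ?u" \<nu>] fd(2) in_S r by auto
  have "\<phi> (y + t *\<^sub>R ?u) - \<phi> y = t * (t * partial \<nu> (partial \<mu> f) (y + r *\<^sub>R ?u + s *\<^sub>R ?v))"
    using r \<phi>(2) S s(3) by simp
  then show ?thesis
    using r s by (intro exI[of _ r] exI[of _ s]) (simp add: \<phi>_def algebra_simps)
qed

text \<open>Schwarz's theorem. At suitable points near x both mixed derivatives equal the same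
  second difference divided by \<open>t * t\<close>; their continuity at x then excludes a gap
  between them.\<close>

lemma partial_commute:
  fixes f :: "real^4 \<Rightarrow> real"
  assumes S: "open S" "x \<in> S" and f: "Ck_on 2 f S"
  shows "partial \<mu> (partial \<nu> f) x = partial \<nu> (partial \<mu> f) x"
proof (rule ccontr)
  let ?a = "partial \<mu> (partial \<nu> f)" and ?b = "partial \<nu> (partial \<mu> f)"
  assume neq: "?a x \<noteq> ?b x"
  \<comment> \<open>Half the gap: a value of \<open>?a\<close> within \<epsilon> of
    \<open>?a x\<close> and a value of \<open>?b\<close> within \<epsilon> of \<open>?b x\<close>
    cannot coincide.\<close>
  define \<epsilon> where "\<epsilon> = \<bar>?a x - ?b x\<bar> / 2"
  have \<epsilon>: "\<epsilon> > 0" using neq by (simp add: \<epsilon>_def)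
  have "continuous_on S ?a" "continuous_on S ?b"
    using f by (auto simp: numeral_2_eq_2)
  then have "isCont ?a x" "isCont ?b x"
    using S continuous_on_eq_continuous_at by blast+
  then obtain d1 d2 where d: "d1 > 0" "d2 > 0"
    "\<And>y. dist y x < d1 \<Longrightarrow> dist (?a y) (?a x) < \<epsilon>"
    "\<And>y. dist y x < d2 \<Longrightarrow> dist (?b y) (?b x) < \<epsilon>"
    using \<epsilon> unfolding continuous_at_eps_delta by metis
  obtain d3 where d3: "d3 > 0" "ball x d3 \<subseteq> S"
    using S open_contains_ball by blast
  define m where "m = min d1 (min d2 d3)"
  \<comment> \<open>Points of the parallelogram with sides \<open>t\<close> have distance at most
    \<open>2 * t\<close> from x, which stays below \<open>m\<close>.\<close>
  define t where "t = m / 3"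
  have m: "m > 0" "t > 0" using d d3 by (auto simp: m_def t_def)
  have near: "dist (x + r *\<^sub>R axis \<alpha> 1 + s *\<^sub>R axis \<beta> 1) x < m"
    if "0 \<le> r" "r \<le> t" "0 \<le> s" "s \<le> t" for r s and \<alpha> \<beta> :: 4
  proof -
    have "dist (x + r *\<^sub>R axis \<alpha> 1 + s *\<^sub>R axis \<beta> 1) x = norm (r *\<^sub>R axis \<alpha> (1::real) + s *\<^sub>R axis \<beta> 1)"
      by (simp add: dist_norm add.assoc)
    also have "\<dots> \<le> r + s"
      using that norm_triangle_ineq[of "r *\<^sub>R axis \<alpha> (1::real)" "s *\<^sub>R axis \<beta> 1"] by simp
    also have "\<dots> < m" using that m by (simp add: t_def)
    finally show ?thesis .
  qed
  have in_S: "x + r *\<^sub>R axis \<alpha> 1 + s *\<^sub>R axis \<beta> 1 \<in> S"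
    if "0 \<le> r" "r \<le> t" "0 \<le> s" "s \<le> t" for r s and \<alpha> \<beta> :: 4
    using near[OF that, of \<alpha> \<beta>] d3 by (auto simp: m_def dist_commute subset_iff)
  obtain r s where 1: "0 < r" "r < t" "0 < s" "s < t"
    "f (x + t *\<^sub>R axis \<mu> 1 + t *\<^sub>R axis \<nu> 1) - f (x + t *\<^sub>R axis \<mu> 1) - f (x + t *\<^sub>R axis \<nu> 1) + f x
    = t * t * ?b (x + r *\<^sub>R axis \<mu> 1 + s *\<^sub>R axis \<nu> 1)"
    using second_difference[OF m(2) in_S f] by blast
  obtain r' s' where 2: "0 < r'" "r' < t" "0 < s'" "s' < t"
    "f (x + t *\<^sub>R axis \<nu> 1 + t *\<^sub>R axis \<mu> 1) - f (x + t *\<^sub>R axis \<nu> 1) - f (x + t *\<^sub>R axis \<mu> 1) + f x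
    = t * t * ?a (x + r' *\<^sub>R axis \<nu> 1 + s' *\<^sub>R axis \<mu> 1)"
    using second_difference[OF m(2) in_S f] by blast
  have "t * t * ?b (x + r *\<^sub>R axis \<mu> 1 + s *\<^sub>R axis \<nu> 1)
      = t * t * ?a (x + r' *\<^sub>R axis \<nu> 1 + s' *\<^sub>R axis \<mu> 1)"
    using 1(5) 2(5) by (simp add: algebra_simps)
  then have "?b (x + r *\<^sub>R axis \<mu> 1 + s *\<^sub>R axis \<nu> 1) = ?a (x + r' *\<^sub>R axis \<nu> 1 + s' *\<^sub>R axis \<mu> 1)"
    using m by simp
  moreover have "dist (?b (x + r *\<^sub>R axis \<mu> 1 + s *\<^sub>R axis \<nu> 1)) (?b x) < \<epsilon>"
    using 1 by (intro d(4) less_le_trans[OF near]) (auto simp: m_def)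
  moreover have "dist (?a (x + r' *\<^sub>R axis \<nu> 1 + s' *\<^sub>R axis \<mu> 1)) (?a x) < \<epsilon>"
    using 2 by (intro d(3) less_le_trans[OF near]) (auto simp: m_def)
  ultimately show False unfolding \<epsilon>_def dist_real_def by argo
qed

section \<open>Matrices\<close>

lemma matrix_diff_ldistrib: "A ** (B - C) = A ** B - A ** (C :: real^'n^'m)"
  by (vector matrix_matrix_mult_def sum_subtractf[symmetric] field_simps)

lemma matrix_add_rdistrib: "(B + C) ** A = B ** A + (C :: real^'n^'m) ** A"
  by (vector matrix_matrix_mult_def sum.distrib[symmetric] field_simps)

lemma matrix_diff_rdistrib: "(B - C) ** A = B ** A - (C :: real^'n^'m) ** A"
  by (vector matrix_matrix_mult_def sum_subtractf[symmetric] field_simps)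

lemmas matrix_distribs = matrix_add_ldistrib matrix_diff_ldistrib matrix_add_rdistrib
  matrix_diff_rdistrib matrix_mul_assoc

lemma matrix_mult_component: "(A ** B) $ i $ j = (\<Sum>k\<in>UNIV. A $ i $ k * B $ k $ j)"
  by (simp add: matrix_matrix_mult_def)

lemma matrix_inv_mult:
  assumes "invertible A"
  shows "A ** matrix_inv A = mat 1" "matrix_inv A ** A = mat 1"
proof -
  have "A ** matrix_inv A = mat 1 \<and> matrix_inv A ** A = mat 1"
    using someI_ex[OF assms[unfolded invertible_def]] by (simp add: matrix_inv_def)
  then show "A ** matrix_inv A = mat 1" "matrix_inv A ** A = mat 1" by auto
qed

lemma matrix_inv_eqI:
  fixes A B :: "real^'n^'n"
  assumes "A ** B = mat 1"
  shows "matrix_inv A = B"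
proof -
  have "invertible A" using assms invertible_right_inverse by blast
  then have "matrix_inv A ** (A ** B) = B"
    by (simp add: matrix_mul_assoc matrix_inv_mult)
  then show ?thesis by (simp add: assms)
qed

text \<open>Cramer's rule with a column of the unit matrix as right-hand side. In this form,
  smoothness of the inverse reduces to smoothness of determinants and of a reciprocal.\<close>

lemma matrix_inv_cramer:
  fixes A :: "real^'n^'n"
  assumes "invertible A"
  shows "matrix_inv A $ k $ j =
    det (\<chi> i l. if l = k then if i = j then 1 else 0 else A $ i $ l) * inverse (det A)"
proof -
  let ?x = "\<chi> i. matrix_inv A $ i $ j"
  have "A *v ?x = (\<chi> i. if i = j then 1 else 0)"
    using matrix_inv_mult(1)[OF assms]
    by (simp add: vec_eq_iff matrix_vector_mult_def matrix_matrix_mult_def mat_def)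
  then have "?x = (\<chi> k. det (\<chi> i l. if l = k then (\<chi> i. if i = j then 1 else 0) $ i else A $ i $ l)
      / det A)"
    using assms cramer invertible_det_nz by blast
  then show ?thesis by (simp add: vec_eq_iff divide_inverse cong: if_cong)
qed

section \<open>Calculus in a chart\<close>

locale coordinate_chart =
  fixes K :: "'m chart"
  assumes open_image: "open (snd K ` fst K)" and inj: "inj_on (snd K) (fst K)"
begin

abbreviation pullback :: "('m \<Rightarrow> real) \<Rightarrow> real^4 \<Rightarrow> real" where
  "pullback f \<equiv> f \<circ> inv_into (fst K) (snd K)"

lemma inv_chart [simp]: "p \<in> fst K \<Longrightarrow> inv_into (fst K) (snd K) (snd K p) = p"
  using inj by (rule inv_into_f_f)

section \<open>Smooth scalars and their coordinate derivatives\<close>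

lemma smooth_in_iff: "smooth_in K f \<longleftrightarrow> (\<forall>k. Ck_on k (pullback f) (snd K ` fst K))"
  by (simp add: smooth_in_def smooth_on_def)

lemma smooth_in_differentiable:
  "smooth_in K f \<Longrightarrow> p \<in> fst K \<Longrightarrow> pullback f differentiable (at (snd K p))"
  unfolding smooth_in_iff by (drule spec[of _ "Suc 0"]) auto

lemma smooth_in_cong:
  assumes "smooth_in K f" "\<And>p. p \<in> fst K \<Longrightarrow> f p = g p"
  shows "smooth_in K g"
  unfolding smooth_in_iff
proof
  fix k
  show "Ck_on k (pullback g) (snd K ` fst K)"
    by (rule Ck_on_cong[OF open_image, of "pullback f"]) (use assms in \<open>auto simp: smooth_in_iff\<close>)
qed

text \<open>Allows identities that hold only on the chart domain to be differentiated: the image of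
  the domain is open, so the derivative at \<open>p\<close> sees no values from outside.\<close>

lemma coord_deriv_cong:
  assumes "smooth_in K f" "p \<in> fst K" "\<And>q. q \<in> fst K \<Longrightarrow> f q = g q"
  shows "coord_deriv K \<mu> f p = coord_deriv K \<mu> g p"
  unfolding coord_deriv_def
  by (rule partial_transform_open[OF smooth_in_differentiable[OF assms(1,2)] open_image])
    (use assms(2,3) in auto)

lemma smooth_in_const: "smooth_in K (\<lambda>p. c)"
  by (simp add: smooth_in_iff comp_def Ck_on_const)

lemma smooth_in_add: "smooth_in K f \<Longrightarrow> smooth_in K g \<Longrightarrow> smooth_in K (\<lambda>p. f p + g p)"
  using Ck_on_add[OF open_image] by (simp add: smooth_in_iff comp_def)

lemma smooth_in_mult: "smooth_in K f \<Longrightarrow> smooth_in K g \<Longrightarrow> smooth_in K (\<lambda>p. f p * g p)"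
  using Ck_on_mult[OF open_image] by (simp add: smooth_in_iff comp_def)

lemma smooth_in_diff: "smooth_in K f \<Longrightarrow> smooth_in K g \<Longrightarrow> smooth_in K (\<lambda>p. f p - g p)"
  using smooth_in_add[OF _ smooth_in_mult[OF smooth_in_const[of "- 1"]], of f g] by simp

lemma smooth_in_sum:
  "finite I \<Longrightarrow> (\<And>i. i \<in> I \<Longrightarrow> smooth_in K (f i)) \<Longrightarrow> smooth_in K (\<lambda>p. \<Sum>i\<in>I. f i p)"
  by (induction I rule: finite_induct) (auto intro: smooth_in_const smooth_in_add)

lemma smooth_in_prod:
  "finite I \<Longrightarrow> (\<And>i. i \<in> I \<Longrightarrow> smooth_in K (f i)) \<Longrightarrow> smooth_in K (\<lambda>p. \<Prod>i\<in>I. f i p)"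
  by (induction I rule: finite_induct) (auto intro: smooth_in_const smooth_in_mult)

lemma smooth_in_inverse:
  assumes "smooth_in K f" "\<And>p. p \<in> fst K \<Longrightarrow> f p \<noteq> 0"
  shows "smooth_in K (\<lambda>p. inverse (f p))"
proof -
  have "pullback f x \<noteq> 0" if "x \<in> snd K ` fst K" for x
    using assms(2) that by auto
  then show ?thesis
    using Ck_on_inverse[OF open_image, of "pullback f"] assms(1) by (simp add: smooth_in_iff comp_def)
qed

lemma smooth_in_coord_deriv:
  assumes "smooth_in K f"
  shows "smooth_in K (coord_deriv K \<mu> f)"
  unfolding smooth_in_iff
proof
  fix k
  show "Ck_on k (pullback (coord_deriv K \<mu> f)) (snd K ` fst K)"
  proof (rule Ck_on_cong[OF open_image, of "partial \<mu> (pullback f)"])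
    show "Ck_on k (partial \<mu> (pullback f)) (snd K ` fst K)"
      using assms unfolding smooth_in_iff by (metis Ck_on.simps(2))
  qed (auto simp: coord_deriv_def)
qed

lemma coord_deriv_const: "coord_deriv K \<mu> (\<lambda>p. c) p = 0"
  by (simp add: coord_deriv_def comp_def partial_const)

lemma coord_deriv_add:
  assumes "smooth_in K f" "smooth_in K g" "p \<in> fst K"
  shows "coord_deriv K \<mu> (\<lambda>q. f q + g q) p = coord_deriv K \<mu> f p + coord_deriv K \<mu> g p"
  using partial_add[OF assms(1,2)[THEN smooth_in_differentiable[OF _ assms(3)]]]
  by (simp add: coord_deriv_def comp_def)

lemma coord_deriv_mult:
  assumes "smooth_in K f" "smooth_in K g" "p \<in> fst K"
  shows "coord_deriv K \<mu> (\<lambda>q. f q * g q) p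
    = f p * coord_deriv K \<mu> g p + coord_deriv K \<mu> f p * g p"
  using partial_mult[OF assms(1,2)[THEN smooth_in_differentiable[OF _ assms(3)]]] assms(3)
  by (simp add: coord_deriv_def comp_def)

lemma coord_deriv_diff:
  assumes "smooth_in K f" "smooth_in K g" "p \<in> fst K"
  shows "coord_deriv K \<mu> (\<lambda>q. f q - g q) p = coord_deriv K \<mu> f p - coord_deriv K \<mu> g p"
  using coord_deriv_add[OF assms(1) smooth_in_mult[OF smooth_in_const[of "- 1"] assms(2)] assms(3)]
    coord_deriv_mult[OF smooth_in_const[of "- 1"] assms(2,3)]
  by (simp add: coord_deriv_const)

lemma coord_deriv_sum:
  assumes "finite I" "\<And>i. i \<in> I \<Longrightarrow> smooth_in K (f i)" "p \<in> fst K"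
  shows "coord_deriv K \<mu> (\<lambda>q. \<Sum>i\<in>I. f i q) p = (\<Sum>i\<in>I. coord_deriv K \<mu> (f i) p)"
  using assms
proof (induction I rule: finite_induct)
  case (insert i I)
  then have "coord_deriv K \<mu> (\<lambda>q. f i q + (\<Sum>i\<in>I. f i q)) p
      = coord_deriv K \<mu> (f i) p + coord_deriv K \<mu> (\<lambda>q. \<Sum>i\<in>I. f i q) p"
    by (intro coord_deriv_add smooth_in_sum) auto
  with insert show ?case by simp
qed (simp add: coord_deriv_const)

lemma coord_deriv_commute:
  assumes "smooth_in K f" "p \<in> fst K"
  shows "coord_deriv K \<mu> (coord_deriv K \<nu> f) p = coord_deriv K \<nu> (coord_deriv K \<mu> f) p"
proof -
  have Ck: "Ck_on k (pullback f) (snd K ` fst K)" for k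
    using assms by (simp add: smooth_in_iff)
  \<comment> \<open>The inner derivative pulls back to a partial derivative on the chart image only;
    since that image is open, the outer derivative does not notice.\<close>
  have "coord_deriv K \<alpha> (coord_deriv K \<beta> f) p = partial \<alpha> (partial \<beta> (pullback f)) (snd K p)" for \<alpha> \<beta>
    unfolding coord_deriv_def[of K \<alpha>]
    by (rule partial_transform_open[OF smooth_in_differentiable open_image])
      (use assms in \<open>auto simp: coord_deriv_def intro: smooth_in_coord_deriv\<close>)
  then show ?thesis
    using partial_commute[OF open_image _ Ck, of "snd K p" \<mu> \<nu>] assms(2) by simp
qed

section \<open>Matrix-valued functions\<close>

definition smooth_mat :: "('m \<Rightarrow> real^4^4) \<Rightarrow> bool" where
  "smooth_mat F \<longleftrightarrow> (\<forall>i j. smooth_in K (\<lambda>p. F p $ i $ j))"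

definition mat_deriv :: "4 \<Rightarrow> ('m \<Rightarrow> real^4^4) \<Rightarrow> 'm \<Rightarrow> real^4^4" where
  "mat_deriv \<mu> F p = (\<chi> i j. coord_deriv K \<mu> (\<lambda>q. F q $ i $ j) p)"

lemma smooth_mat_component: "smooth_mat F \<Longrightarrow> smooth_in K (\<lambda>p. F p $ i $ j)"
  by (simp add: smooth_mat_def)

lemma smooth_mat_const: "smooth_mat (\<lambda>p. A)"
  by (simp add: smooth_mat_def smooth_in_const)

lemma smooth_mat_diff: "smooth_mat F \<Longrightarrow> smooth_mat G \<Longrightarrow> smooth_mat (\<lambda>p. F p - G p)"
  by (simp add: smooth_mat_def smooth_in_diff)

lemma smooth_mat_mult: "smooth_mat F \<Longrightarrow> smooth_mat G \<Longrightarrow> smooth_mat (\<lambda>p. F p ** G p)"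
  by (simp add: smooth_mat_def matrix_mult_component smooth_in_sum smooth_in_mult)

lemma smooth_mat_transpose: "smooth_mat F \<Longrightarrow> smooth_mat (\<lambda>p. transpose (F p))"
  by (simp add: smooth_mat_def transpose_def)

lemma smooth_mat_deriv: "smooth_mat F \<Longrightarrow> smooth_mat (mat_deriv \<mu> F)"
  by (simp add: smooth_mat_def mat_deriv_def smooth_in_coord_deriv)

lemma smooth_in_det: "smooth_mat F \<Longrightarrow> smooth_in K (\<lambda>p. det (F p))"
  unfolding det_def
  by (intro smooth_in_sum smooth_in_mult smooth_in_const smooth_in_prod smooth_mat_component)
    (auto intro: finite_permutations)

lemma smooth_mat_inv:
  assumes "smooth_mat F" "\<And>p. p \<in> fst K \<Longrightarrow> invertible (F p)"
  shows "smooth_mat (\<lambda>p. matrix_inv (F p))"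
  unfolding smooth_mat_def
proof (intro allI)
  fix k j
  let ?G = "\<lambda>p. \<chi> i l. if l = k then if i = j then 1 else 0 else F p $ i $ l"
  show "smooth_in K (\<lambda>p. matrix_inv (F p) $ k $ j)"
  proof (rule smooth_in_cong)
    have "smooth_mat ?G"
      unfolding smooth_mat_def
    proof (intro allI)
      fix i l
      show "smooth_in K (\<lambda>p. ?G p $ i $ l)"
        using assms(1) by (cases "l = k") (auto simp: smooth_in_const smooth_mat_def)
    qed
    then show "smooth_in K (\<lambda>p. det (?G p) * inverse (det (F p)))"
      using assms by (intro smooth_in_mult smooth_in_inverse smooth_in_det)
        (auto simp: invertible_det_nz)
  qed (simp add: matrix_inv_cramer assms(2))
qed

lemma mat_deriv_cong:
  assumes "smooth_mat F" "p \<in> fst K" "\<And>q. q \<in> fst K \<Longrightarrow> F q = G q"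
  shows "mat_deriv \<mu> F p = mat_deriv \<mu> G p"
  using assms coord_deriv_cong[OF smooth_mat_component[OF assms(1)] assms(2)]
  by (simp add: mat_deriv_def vec_eq_iff)

lemma mat_deriv_const: "mat_deriv \<mu> (\<lambda>p. A) p = 0"
  by (simp add: mat_deriv_def coord_deriv_const vec_eq_iff)

lemma mat_deriv_transpose: "mat_deriv \<mu> (\<lambda>p. transpose (F p)) p = transpose (mat_deriv \<mu> F p)"
  by (simp add: mat_deriv_def transpose_def vec_eq_iff)

lemma mat_deriv_diff:
  assumes "smooth_mat F" "smooth_mat G" "p \<in> fst K"
  shows "mat_deriv \<mu> (\<lambda>q. F q - G q) p = mat_deriv \<mu> F p - mat_deriv \<mu> G p"
  using assms by (simp add: mat_deriv_def vec_eq_iff coord_deriv_diff smooth_mat_component)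

lemma mat_deriv_mult:
  assumes "smooth_mat F" "smooth_mat G" "p \<in> fst K"
  shows "mat_deriv \<mu> (\<lambda>q. F q ** G q) p = F p ** mat_deriv \<mu> G p + mat_deriv \<mu> F p ** G p"
  using assms
  by (simp add: mat_deriv_def vec_eq_iff matrix_mult_component coord_deriv_sum coord_deriv_mult
      smooth_in_mult smooth_mat_component sum.distrib)

lemma mat_deriv_commute:
  assumes "smooth_mat F" "p \<in> fst K"
  shows "mat_deriv \<mu> (mat_deriv \<nu> F) p = mat_deriv \<nu> (mat_deriv \<mu> F) p"
  using coord_deriv_commute[OF smooth_mat_component[OF assms(1)] assms(2)]
  by (simp add: mat_deriv_def vec_eq_iff)

end

section \<open>The Levi-Civita connection in a frame\<close>

definition eta_mat :: "real^4^4" where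
  "eta_mat = (\<chi> a b. eta a b)"

lemma eta_commute: "eta a b = eta b a"
  by (simp add: eta_def)

lemma transpose_eta_mat: "transpose eta_mat = eta_mat"
  by (simp add: transpose_def eta_mat_def vec_eq_iff eta_def)

lemma eta_mat_square: "eta_mat ** eta_mat = mat 1"
proof -
  have "(\<Sum>k\<in>UNIV. eta i k * eta k j) = (\<Sum>k\<in>UNIV. if k = i then if i = j then 1 else 0 else 0)" for i j
    by (intro sum.cong refl) (auto simp: eta_def)
  then show ?thesis
    by (simp add: vec_eq_iff matrix_mult_component eta_mat_def mat_def)
qed

lemma transpose_diff: "transpose (A - B) = transpose A - transpose (B :: real^'n^'m)"
  by (simp add: transpose_def vec_eq_iff)

text \<open>Local setting in which \<Gamma> is identified with the Levi-Civita connection. The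
  curvature equation enters later, as an assumption of individual lemmas.\<close>

locale framed_chart = coordinate_chart K for K :: "'m chart" +
  fixes e :: "'m frame" and \<Gamma> :: "'m conn"
  assumes smooth_frame: "smooth_in K (\<lambda>p. e a K p $ \<mu>)"
    and smooth_conn: "smooth_in K (\<Gamma> a c b)"
    and frame_inj: "p \<in> fst K \<Longrightarrow> inj (\<lambda>a. e a K p)"
    and frame_independent: "p \<in> fst K \<Longrightarrow> independent (range (\<lambda>a. e a K p))"
    and metric_comp: "p \<in> fst K \<Longrightarrow> metric_compatible \<Gamma> p"
    and torsion_free: "p \<in> fst K \<Longrightarrow> torsion e \<Gamma> K a c b p = 0"
begin

text \<open>
  The columns of \<open>E\<close> are the frame vectors and the rows of \<open>W\<close> the dual coframe. The connection
  matrices are \<open>N\<^sub>\<mu>\<close> with respect to the frame and \<open>M\<^sub>\<mu>\<close> with respect to the coordinate basis; the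
  definition of \<open>M\<close> solves the gauge transformation \<open>\<partial>\<^sub>\<mu> E + M\<^sub>\<mu> E = E N\<^sub>\<mu>\<close>.
\<close>

definition E :: "'m \<Rightarrow> real^4^4" where
  "E p = (\<chi> \<mu> a. e a K p $ \<mu>)"

definition W :: "'m \<Rightarrow> real^4^4" where
  "W p = matrix_inv (E p)"

definition N :: "4 \<Rightarrow> 'm \<Rightarrow> real^4^4" where
  "N \<mu> p = (\<chi> c b. \<Sum>a\<in>UNIV. W p $ a $ \<mu> * \<Gamma> a c b p)"

definition M :: "4 \<Rightarrow> 'm \<Rightarrow> real^4^4" where
  "M \<mu> p = (E p ** N \<mu> p - mat_deriv \<mu> E p) ** W p"

abbreviation g :: "'m metric_tensor" where
  "g \<equiv> coframe_metric e"

text \<open>\<open>independent\<close> concerns the set of frame vectors, the column criterion the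
  family indexed by a. Injectivity of the family turns coefficients of the one into coefficients of
  the other.\<close>

lemma invertible_E:
  assumes "p \<in> fst K"
  shows "invertible (E p)"
  unfolding invertible_left_inverse matrix_left_invertible_independent_columns
proof (intro allI impI)
  fix c :: "4 \<Rightarrow> real" and i
  assume sum0: "(\<Sum>i\<in>UNIV. c i *s column i (E p)) = 0"
  have col: "column i (E p) = e i K p" for i
    by (simp add: column_def E_def)
  let ?u = "\<lambda>v. c (inv (\<lambda>a. e a K p) v)"
  have "(\<Sum>v\<in>range (\<lambda>a. e a K p). ?u v *\<^sub>R v) = (\<Sum>i\<in>UNIV. c i *s column i (E p))"
    by (subst sum.reindex[OF frame_inj[OF assms]])
      (simp add: inv_f_f[OF frame_inj[OF assms]] col scalar_mult_eq_scaleR)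
  with sum0 have "?u (e i K p) = 0"
    using independentD[OF frame_independent[OF assms], of "range (\<lambda>a. e a K p)" ?u "e i K p"] by simp
  then show "c i = 0"
    by (simp add: inv_f_f[OF frame_inj[OF assms]])
qed

lemma E_W: "p \<in> fst K \<Longrightarrow> E p ** W p = mat 1"
  and W_E: "p \<in> fst K \<Longrightarrow> W p ** E p = mat 1"
  using matrix_inv_mult[OF invertible_E] by (auto simp: W_def)

lemma cancel_E_W: "p \<in> fst K \<Longrightarrow> A ** E p ** W p = A"
  and cancel_W_E: "p \<in> fst K \<Longrightarrow> A ** W p ** E p = A"
  by (simp_all add: E_W W_E flip: matrix_mul_assoc)

lemma E_component: "e a K p $ \<mu> = E p $ \<mu> $ a"
  by (simp add: E_def)

lemma coframe_eq_W: "coframe e K a \<mu> p = W p $ a $ \<mu>"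
  by (simp add: coframe_def W_def E_def)

lemma smooth_E: "smooth_mat E"
  by (simp add: smooth_mat_def E_def smooth_frame)

lemma smooth_W: "smooth_mat W"
  unfolding W_def by (rule smooth_mat_inv[OF smooth_E invertible_E])

lemma smooth_N: "smooth_mat (N \<mu>)"
  using smooth_W
  by (simp add: smooth_mat_def N_def smooth_in_sum smooth_in_mult smooth_conn)

lemma smooth_M: "smooth_mat (M \<mu>)"
  unfolding M_def
  by (intro smooth_mat_mult smooth_mat_diff smooth_E smooth_N smooth_W smooth_mat_deriv)

section \<open>The metric and its inverse in matrix form\<close>

lemma g_eq: "g K p = transpose (W p) ** eta_mat ** W p"
proof -
  have "g K p $ \<mu> $ \<nu> = (transpose (W p) ** eta_mat ** W p) $ \<mu> $ \<nu>" for \<mu> \<nu>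
    unfolding coframe_metric_def vec_lambda_beta coframe_eq_W
    by (subst sum.swap)
      (simp add: matrix_mult_component transpose_def eta_mat_def sum_distrib_left sum_distrib_right
        mult_ac)
  then show ?thesis by (simp add: vec_eq_iff)
qed

lemma smooth_g: "smooth_mat (g K)"
  unfolding g_eq by (intro smooth_mat_mult smooth_mat_transpose smooth_W smooth_mat_const)

lemma transpose_g: "transpose (g K p) = g K p"
  by (simp add: g_eq matrix_transpose_mul transpose_eta_mat matrix_mul_assoc)

lemma frame_orthonormal: "p \<in> fst K \<Longrightarrow> transpose (E p) ** g K p ** E p = eta_mat"
proof -
  assume p: "p \<in> fst K"
  have "transpose (E p) ** g K p ** E p = transpose (W p ** E p) ** eta_mat ** (W p ** E p)"
    by (simp add: g_eq matrix_transpose_mul matrix_mul_assoc)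
  then show ?thesis by (simp add: W_E[OF p])
qed

text \<open>The inverse metric is built from the frame vectors as g is from the dual coframe,
  because \<open>eta_mat\<close> is its own inverse.\<close>

lemma inv_g:
  assumes p: "p \<in> fst K"
  shows "matrix_inv (g K p) = E p ** eta_mat ** transpose (E p)"
proof (rule matrix_inv_eqI)
  have "g K p ** (E p ** eta_mat ** transpose (E p))
      = transpose (W p) ** eta_mat ** (W p ** E p) ** eta_mat ** transpose (E p)"
    by (simp add: g_eq matrix_mul_assoc)
  also have "\<dots> = transpose (W p) ** (eta_mat ** eta_mat) ** transpose (E p)"
    by (simp add: W_E[OF p] matrix_mul_assoc)
  also have "\<dots> = mat 1"
    by (simp add: eta_mat_square E_W[OF p] flip: matrix_transpose_mul)
  finally show "g K p ** (E p ** eta_mat ** transpose (E p)) = mat 1" .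
qed

section \<open>Derivatives of frame, coframe and metric\<close>

lemma deriv_E:
  assumes p: "p \<in> fst K"
  shows "mat_deriv \<mu> E p = E p ** N \<mu> p - M \<mu> p ** E p"
  by (simp add: M_def cancel_W_E[OF p])

text \<open>Obtained by differentiating \<open>E q ** W q = mat 1\<close>, so that no derivative of
  a matrix inverse has to be computed.\<close>

lemma deriv_W:
  assumes p: "p \<in> fst K"
  shows "mat_deriv \<mu> W p = W p ** M \<mu> p - N \<mu> p ** W p"
proof -
  have "mat_deriv \<mu> (\<lambda>q. E q ** W q) p = 0"
    using mat_deriv_cong[OF smooth_mat_mult[OF smooth_E smooth_W] p, of "\<lambda>q. mat 1"] E_W
    by (simp add: mat_deriv_const)
  then have "E p ** mat_deriv \<mu> W p = - (mat_deriv \<mu> E p ** W p)"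
    by (simp add: mat_deriv_mult[OF smooth_E smooth_W p] add_eq_0_iff2)
  also have "\<dots> = M \<mu> p - E p ** N \<mu> p ** W p"
    by (simp add: deriv_E[OF p] matrix_diff_rdistrib cancel_E_W[OF p])
  finally have "W p ** (E p ** mat_deriv \<mu> W p) = W p ** (M \<mu> p - E p ** N \<mu> p ** W p)"
    by simp
  then show ?thesis
    by (simp add: matrix_distribs W_E[OF p])
qed

text \<open>Contraction of the compatibility condition with the coframe: each connection matrix with
  respect to the frame lies in the Lie algebra of the Lorentz group.\<close>

lemma metric_N:
  assumes p: "p \<in> fst K"
  shows "transpose (N \<mu> p) ** eta_mat + eta_mat ** N \<mu> p = 0"
proof -
  have "(\<Sum>b\<in>UNIV. (\<Sum>a\<in>UNIV. W p $ a $ \<mu> * \<Gamma> a b c p) * eta b d)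
      + (\<Sum>b\<in>UNIV. eta c b * (\<Sum>a\<in>UNIV. W p $ a $ \<mu> * \<Gamma> a b d p)) = 0" for c d
  proof -
    have "(\<Sum>b\<in>UNIV. (\<Sum>a\<in>UNIV. W p $ a $ \<mu> * \<Gamma> a b c p) * eta b d)
        + (\<Sum>b\<in>UNIV. eta c b * (\<Sum>a\<in>UNIV. W p $ a $ \<mu> * \<Gamma> a b d p))
      = (\<Sum>b\<in>UNIV. \<Sum>a\<in>UNIV. W p $ a $ \<mu> * (\<Gamma> a b c p * eta b d + \<Gamma> a b d p * eta b c))"
      by (simp add: sum_distrib_left sum_distrib_right eta_commute[of c] algebra_simps sum.distrib)
    also have "\<dots> = (\<Sum>a\<in>UNIV. W p $ a $ \<mu> *
        ((\<Sum>b\<in>UNIV. \<Gamma> a b c p * eta b d) + (\<Sum>b\<in>UNIV. \<Gamma> a b d p * eta b c)))"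
      by (subst sum.swap) (simp add: sum_distrib_left sum.distrib algebra_simps)
    also have "\<dots> = 0"
      using metric_comp[OF p] by (simp add: metric_compatible_def)
    finally show ?thesis .
  qed
  then show ?thesis
    by (simp add: vec_eq_iff matrix_mult_component transpose_def N_def eta_mat_def)
qed

text \<open>This is covariant constancy of g for the connection \<open>M\<close>. After
  \<open>deriv_W\<close> is inserted, the terms in \<open>N\<close> assemble into the expression
  that vanishes by \<open>metric_N\<close>.\<close>

lemma deriv_g:
  assumes p: "p \<in> fst K"
  shows "mat_deriv \<mu> (g K) p = transpose (M \<mu> p) ** g K p + g K p ** M \<mu> p"
proof -
  let ?W = "W p" and ?H = eta_mat and ?N = "N \<mu> p" and ?M = "M \<mu> p"
  have "mat_deriv \<mu> (g K) p = transpose ?W ** ?H ** mat_deriv \<mu> W p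
      + transpose (mat_deriv \<mu> W p) ** ?H ** ?W"
    unfolding g_eq
    by (simp add: mat_deriv_mult mat_deriv_const mat_deriv_transpose smooth_mat_mult
        smooth_mat_transpose smooth_W smooth_mat_const p)
  also have "\<dots> = transpose ?M ** g K p + g K p ** ?M
      - transpose ?W ** (transpose ?N ** ?H + ?H ** ?N) ** ?W"
    by (simp add: deriv_W[OF p] g_eq transpose_diff matrix_transpose_mul matrix_distribs)
  finally show ?thesis by (simp add: metric_N[OF p])
qed

section \<open>Vanishing torsion and the Christoffel symbols\<close>

lemma bracket_component:
  assumes p: "p \<in> fst K"
  shows "(\<Sum>\<nu>\<in>UNIV. E p $ \<nu> $ a * mat_deriv \<nu> E p $ \<tau> $ b)
      - (\<Sum>\<nu>\<in>UNIV. E p $ \<nu> $ b * mat_deriv \<nu> E p $ \<tau> $ a)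
    = (\<Sum>c\<in>UNIV. E p $ \<tau> $ c * (\<Gamma> a c b p - \<Gamma> b c a p))"
proof -
  let ?v = "lie_bracket (e a) (e b) K p"
  have "W p *v ?v = (\<chi> c. \<Gamma> a c b p - \<Gamma> b c a p)"
    using torsion_free[OF p]
    by (simp add: torsion_def coframe_eq_W vec_eq_iff matrix_vector_mult_def)
  \<comment> \<open>Applying \<open>E p\<close> strips off the coframe with which the torsion
    contracts the bracket.\<close>
  then have "E p *v (W p *v ?v) = E p *v (\<chi> c. \<Gamma> a c b p - \<Gamma> b c a p)"
    by simp
  then have "?v $ \<tau> = (\<Sum>c\<in>UNIV. E p $ \<tau> $ c * (\<Gamma> a c b p - \<Gamma> b c a p))"
    by (simp add: matrix_vector_mul_assoc E_W[OF p]) (simp add: matrix_vector_mult_def)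
  then show ?thesis
    by (simp add: lie_bracket_def mat_deriv_def E_def sum_subtractf)
qed

text \<open>\<open>N\<close> arises from \<Gamma> by contraction with the coframe; contraction with
  the frame undoes this.\<close>

lemma contract_N:
  assumes p: "p \<in> fst K"
  shows "(\<Sum>\<mu>\<in>UNIV. E p $ \<mu> $ a * N \<mu> p $ c $ b) = \<Gamma> a c b p"
proof -
  have "(\<Sum>\<mu>\<in>UNIV. E p $ \<mu> $ a * N \<mu> p $ c $ b)
      = (\<Sum>f\<in>UNIV. (\<Sum>\<mu>\<in>UNIV. W p $ f $ \<mu> * E p $ \<mu> $ a) * \<Gamma> f c b p)"
    unfolding N_def by (simp add: sum_distrib_left sum_distrib_right mult_ac) (rule sum.swap)
  also have "\<dots> = (\<Sum>f\<in>UNIV. (W p ** E p) $ f $ a * \<Gamma> f c b p)"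
    by (simp add: matrix_mult_component)
  also have "\<dots> = (\<Sum>f\<in>UNIV. if f = a then \<Gamma> f c b p else 0)"
    by (intro sum.cong refl) (simp add: W_E[OF p] mat_def)
  finally show ?thesis by simp
qed

text \<open>For fixed \<tau>, symmetry may be tested after both lower indices are contracted with
  the frame. There the antisymmetric part is, up to sign, the \<tau>-component of the
  torsion.\<close>

lemma M_symmetric:
  assumes p: "p \<in> fst K"
  shows "M \<mu> p $ \<tau> $ \<sigma> = M \<sigma> p $ \<tau> $ \<mu>"
proof -
  define S :: "real^4^4" where "S = (\<chi> \<mu> \<sigma>. M \<mu> p $ \<tau> $ \<sigma>)"
  define Q where "Q = transpose (E p) ** S ** E p"
  have Q: "Q $ a $ b = (\<Sum>c\<in>UNIV. E p $ \<tau> $ c * \<Gamma> a c b p)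
      - (\<Sum>\<mu>\<in>UNIV. E p $ \<mu> $ a * mat_deriv \<mu> E p $ \<tau> $ b)" for a b
  proof -
    have "Q $ a $ b = (\<Sum>\<mu>\<in>UNIV. E p $ \<mu> $ a * (M \<mu> p ** E p) $ \<tau> $ b)"
      unfolding Q_def S_def
      by (simp add: matrix_mult_component transpose_def flip: matrix_mul_assoc)
    also have "\<dots> = (\<Sum>\<mu>\<in>UNIV. E p $ \<mu> $ a * (E p ** N \<mu> p) $ \<tau> $ b)
        - (\<Sum>\<mu>\<in>UNIV. E p $ \<mu> $ a * mat_deriv \<mu> E p $ \<tau> $ b)"
      by (simp add: deriv_E[OF p] algebra_simps flip: sum_subtractf)
    also have "(\<Sum>\<mu>\<in>UNIV. E p $ \<mu> $ a * (E p ** N \<mu> p) $ \<tau> $ b)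
        = (\<Sum>c\<in>UNIV. E p $ \<tau> $ c * (\<Sum>\<mu>\<in>UNIV. E p $ \<mu> $ a * N \<mu> p $ c $ b))"
      by (simp add: matrix_mult_component sum_distrib_left mult_ac) (rule sum.swap)
    finally show ?thesis by (simp add: contract_N[OF p])
  qed
  \<comment> \<open>The antisymmetric part of the \<Gamma>-terms of \<open>Q\<close> is the bracket
    of the frame vectors, which the derivative terms supply as well.\<close>
  have "Q $ a $ b = Q $ b $ a" for a b
    using bracket_component[OF p, of a \<tau> b]
    by (simp add: Q right_diff_distrib sum_subtractf)
  then have "transpose Q = Q"
    by (simp add: transpose_def vec_eq_iff)
  moreover have "S = transpose (W p) ** Q ** W p"
  proof -
    have "transpose (W p) ** Q ** W p = transpose (E p ** W p) ** S ** (E p ** W p)"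
      by (simp add: Q_def matrix_transpose_mul matrix_mul_assoc)
    then show ?thesis by (simp add: E_W[OF p])
  qed
  ultimately have "transpose S = S"
    by (metis matrix_transpose_mul matrix_mul_assoc transpose_transpose)
  then show ?thesis
    by (simp add: S_def transpose_def vec_eq_iff)
qed

lemma christoffel_eq:
  assumes p: "p \<in> fst K"
  shows "christoffel g K \<tau> \<mu> \<nu> p = M \<mu> p $ \<tau> $ \<nu>"
proof -
  have g_sym: "g K p $ \<alpha> $ \<beta> = g K p $ \<beta> $ \<alpha>" for \<alpha> \<beta>
    using transpose_g[of p] by (simp add: transpose_def vec_eq_iff)
  have dg: "coord_deriv K \<alpha> (\<lambda>q. g K q $ \<beta> $ \<gamma>) p
      = (\<Sum>\<kappa>\<in>UNIV. M \<alpha> p $ \<kappa> $ \<beta> * g K p $ \<kappa> $ \<gamma>) + (\<Sum>\<kappa>\<in>UNIV. g K p $ \<beta> $ \<kappa> * M \<alpha> p $ \<kappa> $ \<gamma>)"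
    for \<alpha> \<beta> \<gamma>
    using deriv_g[OF p, of \<alpha>]
    by (simp add: vec_eq_iff mat_deriv_def matrix_mult_component transpose_def)
  \<comment> \<open>Koszul's formula: four of the six terms cancel by the symmetry of \<open>M\<close>.\<close>
  have "coord_deriv K \<mu> (\<lambda>q. g K q $ \<sigma> $ \<nu>) p + coord_deriv K \<nu> (\<lambda>q. g K q $ \<sigma> $ \<mu>) p
      - coord_deriv K \<sigma> (\<lambda>q. g K q $ \<mu> $ \<nu>) p = 2 * (g K p ** M \<mu> p) $ \<sigma> $ \<nu>" for \<sigma>
    unfolding dg matrix_mult_component
    by (simp add: M_symmetric[OF p, of \<nu> _ \<mu>] M_symmetric[OF p, of \<sigma>] g_sym[of \<sigma>] g_sym[of _ \<nu>]
       g_sym[of _ \<mu>] mult.commute)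
  then have "christoffel g K \<tau> \<mu> \<nu> p = (matrix_inv (g K p) ** (g K p ** M \<mu> p)) $ \<tau> $ \<nu>"
    by (simp add: christoffel_def inv_metric_def matrix_mult_component sum_distrib_left
        sum_distrib_right)
  moreover have "matrix_inv (g K p) ** g K p = mat 1"
  proof -
    have "matrix_inv (g K p) ** g K p
       = E p ** eta_mat ** transpose (W p ** E p) ** eta_mat ** W p"
      unfolding inv_g[OF p] unfolding g_eq by (simp add: matrix_transpose_mul matrix_mul_assoc)
    also have "\<dots> = E p ** (eta_mat ** eta_mat) ** W p"
      by (simp add: W_E[OF p] matrix_mul_assoc)
    finally show ?thesis by (simp add: eta_mat_square E_W[OF p])
  qed
  ultimately show ?thesis by (simp add: matrix_mul_assoc)
qed

section \<open>Curvature in the coordinate basis and in the frame\<close>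

definition curv_coord :: "4 \<Rightarrow> 4 \<Rightarrow> 'm \<Rightarrow> real^4^4" where
  "curv_coord \<mu> \<nu> p = mat_deriv \<mu> (M \<nu>) p - mat_deriv \<nu> (M \<mu>) p
     + M \<mu> p ** M \<nu> p - M \<nu> p ** M \<mu> p"

text \<open>Like \<open>curv_coord\<close>, the curvature two-form with both form indices in
  coordinates. Here the matrix indices refer to the frame, there to the coordinate basis.\<close>

definition curv_conn :: "4 \<Rightarrow> 4 \<Rightarrow> 'm \<Rightarrow> real^4^4" where
  "curv_conn \<mu> \<nu> p = mat_deriv \<mu> (N \<nu>) p - mat_deriv \<nu> (N \<mu>) p
     + N \<mu> p ** N \<nu> p - N \<nu> p ** N \<mu> p"

lemma riemann_eq:
  assumes p: "p \<in> fst K"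
  shows "riemann g K \<tau> \<sigma> \<mu> \<nu> p = curv_coord \<mu> \<nu> p $ \<tau> $ \<sigma>"
proof -
  have "coord_deriv K \<alpha> (christoffel g K \<tau> \<beta> \<sigma>) p = mat_deriv \<alpha> (M \<beta>) p $ \<tau> $ \<sigma>" for \<alpha> \<beta>
    unfolding mat_deriv_def vec_lambda_beta
    by (rule coord_deriv_cong[OF smooth_mat_component[OF smooth_M] p, symmetric])
      (simp add: christoffel_eq)
  then show ?thesis
    by (simp add: riemann_def curv_coord_def christoffel_eq[OF p] matrix_mult_component
        sum_subtractf)
qed

lemma curv_coord_E:
  assumes p: "p \<in> fst K"
  shows "curv_coord \<mu> \<nu> p ** E p = E p ** curv_conn \<mu> \<nu> p"
proof -
  \<comment> \<open>Integrability of \<open>\<partial>\<^sub>\<mu> E = E N\<^sub>\<mu> - M\<^sub>\<mu> E\<close>: the symmetry of \<open>\<partial>\<^sub>\<alpha> \<partial>\<^sub>\<beta> E\<close> relates both curvatures.\<close>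
  have dd: "mat_deriv \<alpha> (mat_deriv \<beta> E) p
      = E p ** mat_deriv \<alpha> (N \<beta>) p + (E p ** N \<alpha> p - M \<alpha> p ** E p) ** N \<beta> p
        - (M \<beta> p ** (E p ** N \<alpha> p - M \<alpha> p ** E p) + mat_deriv \<alpha> (M \<beta>) p ** E p)" for \<alpha> \<beta>
  proof -
    have "mat_deriv \<alpha> (mat_deriv \<beta> E) p = mat_deriv \<alpha> (\<lambda>q. E q ** N \<beta> q - M \<beta> q ** E q) p"
      by (rule mat_deriv_cong[OF smooth_mat_deriv[OF smooth_E] p deriv_E])
    then show ?thesis
      by (simp add: mat_deriv_diff mat_deriv_mult smooth_mat_mult smooth_E smooth_N smooth_M p
          flip: deriv_E)
  qed
  \<comment> \<open>The terms containing both \<open>M\<close> and \<open>N\<close> are symmetric in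
    the two directions and cancel in the difference.\<close>
  show ?thesis
    using mat_deriv_commute[OF smooth_E p, of \<mu> \<nu>]
    unfolding dd curv_coord_def curv_conn_def matrix_distribs
    by (simp add: algebra_simps)
qed

lemma contract_curv_conn:
  assumes p: "p \<in> fst K"
  shows "(\<Sum>\<mu>\<in>UNIV. \<Sum>\<nu>\<in>UNIV. E p $ \<mu> $ a * E p $ \<nu> $ b * curv_conn \<mu> \<nu> p $ c $ d)
    = curv_hat e \<Gamma> K c d a b p"
proof -
  \<comment> \<open>Differentiating \<open>E\<^sup>\<nu>\<^sub>\<beta> N\<^sub>\<nu> = \<Gamma>\<^sub>\<beta>\<close> avoids derivatives of the coframe.\<close>
  have dN: "(\<Sum>\<nu>\<in>UNIV. E p $ \<nu> $ \<beta> * mat_deriv \<mu> (N \<nu>) p $ c $ d)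
      = coord_deriv K \<mu> (\<Gamma> \<beta> c d) p - (\<Sum>\<nu>\<in>UNIV. mat_deriv \<mu> E p $ \<nu> $ \<beta> * N \<nu> p $ c $ d)"
    for \<mu> \<beta>
  proof -
    have sm: "smooth_in K (\<lambda>q. E q $ \<nu> $ \<beta>)" "smooth_in K (\<lambda>q. N \<nu> q $ c $ d)" for \<nu>
      by (rule smooth_mat_component[OF smooth_E], rule smooth_mat_component[OF smooth_N])
    have "coord_deriv K \<mu> (\<Gamma> \<beta> c d) p
        = coord_deriv K \<mu> (\<lambda>q. \<Sum>\<nu>\<in>UNIV. E q $ \<nu> $ \<beta> * N \<nu> q $ c $ d) p"
      by (rule coord_deriv_cong[OF smooth_conn p]) (simp add: contract_N)
    also have "\<dots> = (\<Sum>\<nu>\<in>UNIV. E p $ \<nu> $ \<beta> * mat_deriv \<mu> (N \<nu>) p $ c $ d)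
        + (\<Sum>\<nu>\<in>UNIV. mat_deriv \<mu> E p $ \<nu> $ \<beta> * N \<nu> p $ c $ d)"
      using p sm by (simp add: coord_deriv_sum coord_deriv_mult smooth_in_mult mat_deriv_def
          sum.distrib)
    finally show ?thesis by simp
  qed
  \<comment> \<open>\<open>B\<close> collects the terms in which the derivative falls on the frame.
    Its antisymmetric part is a bracket of frame vectors, which \<open>bracket_component\<close>
    expresses by \<Gamma>.\<close>
  define B where "B a b = (\<Sum>\<nu>\<in>UNIV.
    (\<Sum>\<mu>\<in>UNIV. E p $ \<mu> $ a * mat_deriv \<mu> E p $ \<nu> $ b) * N \<nu> p $ c $ d)" for a b
  have part1: "(\<Sum>\<mu>\<in>UNIV. \<Sum>\<nu>\<in>UNIV. E p $ \<mu> $ a * E p $ \<nu> $ b * mat_deriv \<mu> (N \<nu>) p $ c $ d)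
      = frame_deriv e K a (\<Gamma> b c d) p - B a b" for a b
  proof -
    have "(\<Sum>\<mu>\<in>UNIV. \<Sum>\<nu>\<in>UNIV. E p $ \<mu> $ a * E p $ \<nu> $ b * mat_deriv \<mu> (N \<nu>) p $ c $ d)
       = (\<Sum>\<mu>\<in>UNIV. E p $ \<mu> $ a * (\<Sum>\<nu>\<in>UNIV. E p $ \<nu> $ b * mat_deriv \<mu> (N \<nu>) p $ c $ d))"
      by (simp add: sum_distrib_left mult_ac)
    also have "\<dots> = frame_deriv e K a (\<Gamma> b c d) p
        - (\<Sum>\<mu>\<in>UNIV. E p $ \<mu> $ a * (\<Sum>\<nu>\<in>UNIV. mat_deriv \<mu> E p $ \<nu> $ b * N \<nu> p $ c $ d))"
      by (simp add: dN frame_deriv_def E_component right_diff_distrib sum_subtractf)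
    also have "(\<Sum>\<mu>\<in>UNIV. E p $ \<mu> $ a * (\<Sum>\<nu>\<in>UNIV. mat_deriv \<mu> E p $ \<nu> $ b * N \<nu> p $ c $ d)) = B a b"
      by (simp add: B_def sum_distrib_left sum_distrib_right mult_ac) (rule sum.swap)
    finally show ?thesis .
  qed
  have "B a b - B b a = (\<Sum>\<nu>\<in>UNIV. (\<Sum>f\<in>UNIV. E p $ \<nu> $ f * (\<Gamma> a f b p - \<Gamma> b f a p)) * N \<nu> p $ c $ d)"
    unfolding B_def bracket_component[OF p, symmetric]
    by (simp add: left_diff_distrib sum_subtractf)
  also have "\<dots> = (\<Sum>f\<in>UNIV. (\<Gamma> a f b p - \<Gamma> b f a p) * (\<Sum>\<nu>\<in>UNIV. E p $ \<nu> $ f * N \<nu> p $ c $ d))"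
    by (simp add: sum_distrib_left sum_distrib_right mult_ac) (rule sum.swap)
  finally have BB: "B a b - B b a = (\<Sum>f\<in>UNIV. (\<Gamma> a f b p - \<Gamma> b f a p) * \<Gamma> f c d p)"
    by (simp add: contract_N[OF p])
  have NN: "(\<Sum>\<mu>\<in>UNIV. \<Sum>\<nu>\<in>UNIV. E p $ \<mu> $ a * E p $ \<nu> $ b * (N \<mu> p ** N \<nu> p) $ c $ d)
      = (\<Sum>f\<in>UNIV. \<Gamma> a c f p * \<Gamma> b f d p)" for a b
  proof -
    have "(\<Sum>f\<in>UNIV. \<Gamma> a c f p * \<Gamma> b f d p)
      = (\<Sum>f\<in>UNIV. \<Sum>\<mu>\<in>UNIV. \<Sum>\<nu>\<in>UNIV. E p $ \<mu> $ a * N \<mu> p $ c $ f * (E p $ \<nu> $ b * N \<nu> p $ f $ d))"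
      by (simp add: sum_product flip: contract_N[OF p])
    also have "\<dots> = (\<Sum>\<mu>\<in>UNIV. \<Sum>\<nu>\<in>UNIV. \<Sum>f\<in>UNIV. E p $ \<mu> $ a * N \<mu> p $ c $ f * (E p $ \<nu> $ b * N \<nu> p $ f $ d))"
      by (subst sum.swap) (intro sum.cong refl sum.swap)
    finally show ?thesis
      by (simp add: matrix_mult_component sum_distrib_left mult_ac)
  qed
  \<comment> \<open>Turns the exchange of \<mu> and \<nu> in the subtracted terms into an exchange
    of a and b, so that \<open>part1\<close> and \<open>NN\<close> cover them too.\<close>
  have swap: "(\<Sum>\<mu>\<in>UNIV. \<Sum>\<nu>\<in>UNIV. E p $ \<mu> $ a * E p $ \<nu> $ b * X \<nu> \<mu>)
      = (\<Sum>\<mu>\<in>UNIV. \<Sum>\<nu>\<in>UNIV. E p $ \<mu> $ b * E p $ \<nu> $ a * X \<mu> \<nu>)" for X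
    by (subst sum.swap) (simp add: mult_ac)
  have "(\<Sum>\<mu>\<in>UNIV. \<Sum>\<nu>\<in>UNIV. E p $ \<mu> $ a * E p $ \<nu> $ b * curv_conn \<mu> \<nu> p $ c $ d)
    = (frame_deriv e K a (\<Gamma> b c d) p - B a b) - (frame_deriv e K b (\<Gamma> a c d) p - B b a)
      + (\<Sum>f\<in>UNIV. \<Gamma> a c f p * \<Gamma> b f d p) - (\<Sum>f\<in>UNIV. \<Gamma> b c f p * \<Gamma> a f d p)"
    unfolding part1[symmetric] NN[symmetric]
    unfolding swap[of "\<lambda>\<mu> \<nu>. mat_deriv \<mu> (N \<nu>) p $ c $ d", symmetric]
      swap[of "\<lambda>\<mu> \<nu>. (N \<mu> p ** N \<nu> p) $ c $ d", symmetric]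
    by (simp add: curv_conn_def algebra_simps sum.distrib sum_subtractf)
  then show ?thesis
    using BB torsion_free[OF p]
    by (simp add: curv_hat_def algebra_simps sum_subtractf)
qed

text \<open>Conjugation with the frame matrix turns \<open>curv_coord\<close> into
  \<open>curv_conn\<close>, which accounts for the indices d and a;
  \<open>contract_curv_conn\<close> accounts for b and c.\<close>

lemma frame_comp13_riemann:
  assumes p: "p \<in> fst K"
  shows "frame_comp13 e K (riemann g K) d a b c p = curv_hat e \<Gamma> K d a b c p"
proof -
  have WRE: "(W p ** curv_coord \<mu> \<nu> p ** E p) = curv_conn \<mu> \<nu> p" for \<mu> \<nu>
    by (simp add: curv_coord_E[OF p] W_E[OF p] matrix_mul_assoc flip: matrix_mul_assoc[of "W p" "curv_coord \<mu> \<nu> p"])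
  have "frame_comp13 e K (riemann g K) d a b c p = (\<Sum>\<tau>\<in>UNIV. \<Sum>\<sigma>\<in>UNIV. \<Sum>\<mu>\<in>UNIV. \<Sum>\<nu>\<in>UNIV.
      E p $ \<mu> $ b * E p $ \<nu> $ c * (W p $ d $ \<tau> * curv_coord \<mu> \<nu> p $ \<tau> $ \<sigma> * E p $ \<sigma> $ a))"
    by (simp add: frame_comp13_def riemann_eq[OF p] coframe_eq_W E_component mult_ac)
  also have "\<dots> = (\<Sum>\<mu>\<in>UNIV. \<Sum>\<nu>\<in>UNIV. \<Sum>\<sigma>\<in>UNIV. \<Sum>\<tau>\<in>UNIV.
      E p $ \<mu> $ b * E p $ \<nu> $ c * (W p $ d $ \<tau> * curv_coord \<mu> \<nu> p $ \<tau> $ \<sigma> * E p $ \<sigma> $ a))"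
    unfolding sum.cartesian_product
    by (rule sum.reindex_bij_witness[of _ "\<lambda>(\<mu>, \<nu>, \<sigma>, \<tau>). (\<tau>, \<sigma>, \<mu>, \<nu>)" "\<lambda>(\<tau>, \<sigma>, \<mu>, \<nu>). (\<mu>, \<nu>, \<sigma>, \<tau>)"])
      auto
  also have "\<dots> = (\<Sum>\<mu>\<in>UNIV. \<Sum>\<nu>\<in>UNIV. E p $ \<mu> $ b * E p $ \<nu> $ c *
      (W p ** curv_coord \<mu> \<nu> p ** E p) $ d $ a)"
    by (simp add: matrix_mult_component sum_distrib_left sum_distrib_right mult_ac)
  finally show ?thesis
    by (simp add: WRE contract_curv_conn[OF p])
qed

end

section \<open>Frame components of the curvature\<close>

lemma sum_eta_left: "(\<Sum>x\<in>UNIV. eta a x * f x) = eta a a * f a"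
proof -
  have "(\<Sum>x\<in>UNIV. eta a x * f x) = (\<Sum>x\<in>UNIV. if x = a then eta a a * f a else 0)"
    by (intro sum.cong refl) (auto simp: eta_def)
  then show ?thesis by simp
qed

lemma sum_delta_left: "(\<Sum>x\<in>UNIV. delta a x * f x) = f a"
proof -
  have "(\<Sum>x\<in>UNIV. delta a x * f x) = (\<Sum>x\<in>UNIV. if x = a then f a else 0)"
    by (intro sum.cong refl) (auto simp: delta_def)
  then show ?thesis by simp
qed

lemma sum_delta_right: "(\<Sum>x\<in>UNIV. delta x a * f x) = f a"
  using sum_delta_left[of a f] by (simp add: delta_def eq_commute[of a])

lemma twice_asym: "2 * asym t a b = t a b - t b a"
  by (simp add: asym_def)

lemma eta_diag_square: "eta a a * eta a a = 1"
  by (simp add: eta_def)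

lemma eta_trace_diag: "eta_trace T p = (\<Sum>a\<in>UNIV. eta a a * T a a p)"
  by (simp add: eta_trace_def sum_eta_left)

lemma raise2_diag: "raise2 L c d p = eta d d * L c d p"
proof -
  have "raise2 L c d p = (\<Sum>f\<in>UNIV. eta d f * L c f p)"
    unfolding raise2_def by (intro sum.cong refl) (simp add: eta_def)
  then show ?thesis by (simp only: sum_eta_left)
qed

text \<open>The algebraic relation between the Ricci and the Schouten tensor in dimension
  four.\<close>

lemma rho_curv_contract:
  assumes "\<And>a b. L a b p = L b a p" "\<And>a b. (\<Sum>c\<in>UNIV. C c a c b p) = 0"
  shows "(\<Sum>d\<in>UNIV. rho_curv L C d a d b p) = 2 * L a b p + eta a b * eta_trace L p"
proof -
  have "rho_curv L C d a d b p = C d a d b p + L a b p - delta d b * L d a p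
      - eta a d * (eta d d * L b d p) + eta a b * (eta d d * L d d p)" for d
    by (simp add: rho_curv_def twice_asym raise2_diag delta_def assms(1)[of b a])
  \<comment> \<open>The 0 is the trace of \<open>C\<close> and the 4 is the dimension; two of the
    four copies of \<open>L a b p\<close> are then cancelled by the terms that follow.\<close>
  then have "(\<Sum>d\<in>UNIV. rho_curv L C d a d b p)
      = 0 + 4 * L a b p - L b a p - eta a a * (eta a a * L b a p) + eta a b * eta_trace L p"
    by (simp add: sum.distrib sum_subtractf assms(2) sum_delta_right sum_eta_left
        eta_trace_diag flip: sum_distrib_left)
  also have "eta a a * (eta a a * L b a p) = L a b p"
    using assms(1) by (simp add: eta_diag_square flip: mult.assoc)
  finally show ?thesis using assms(1)[of b a] by simp
qed

text \<open>Since eta has trace 4 with respect to itself, the factor is \<kappa>/2 times 1 -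
  4/3.\<close>

lemma eta_trace_L_hat: "eta_trace (L_hat \<kappa> T) p = - \<kappa> / 6 * eta_trace T p"
proof -
  have "eta a a * L_hat \<kappa> T a a p
      = \<kappa> / 2 * (eta a a * T a a p) - \<kappa> / 6 * (eta a a * eta a a) * eta_trace T p" for a
    by (simp add: L_hat_def algebra_simps)
  then have "eta_trace (L_hat \<kappa> T) p
      = \<kappa> / 2 * (\<Sum>a\<in>UNIV. eta a a * T a a p) - 4 * (\<kappa> / 6 * eta_trace T p)"
    unfolding eta_trace_diag[of "L_hat \<kappa> T"] eta_diag_square sum_distrib_left[of "\<kappa> / 2"]
    by (simp add: sum_subtractf)
  then show ?thesis
    unfolding eta_trace_diag[of T, symmetric] by simp
qed

context framed_chart
begin

section \<open>Frame components of the metric, Ricci and Schouten tensors\<close>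

lemma frame_comp2_g: "p \<in> fst K \<Longrightarrow> frame_comp2 e K (\<lambda>\<mu> \<nu> p. g K p $ \<mu> $ \<nu>) a b p = eta a b"
proof -
  assume p: "p \<in> fst K"
  have "frame_comp2 e K (\<lambda>\<mu> \<nu> p. g K p $ \<mu> $ \<nu>) a b p = (transpose (E p) ** g K p ** E p) $ a $ b"
    unfolding frame_comp2_def E_component
    by (subst sum.swap)
      (simp add: matrix_mult_component transpose_def sum_distrib_left sum_distrib_right mult_ac)
  then show ?thesis by (simp add: frame_orthonormal[OF p] eta_mat_def)
qed

lemma contract_E_W:
  assumes p: "p \<in> fst K"
  shows "(\<Sum>d\<in>UNIV. E p $ \<mu> $ d * W p $ d $ \<nu>) = delta \<mu> \<nu>"
  using E_W[OF p] by (simp add: vec_eq_iff matrix_mult_component mat_def delta_def)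

lemma contract_W_E:
  assumes p: "p \<in> fst K"
  shows "(\<Sum>\<mu>\<in>UNIV. W p $ a $ \<mu> * E p $ \<mu> $ b) = delta a b"
  using W_E[OF p] by (simp add: vec_eq_iff matrix_mult_component mat_def delta_def)

text \<open>Contraction commutes with passing to frame components: summed over the frame index,
  frame vectors against dual covectors give the identity (\<open>contract_E_W\<close>).\<close>

lemma frame_comp2_contract:
  assumes p: "p \<in> fst K"
  shows "frame_comp2 e K (\<lambda>\<sigma> \<nu> q. \<Sum>\<tau>\<in>UNIV. S \<tau> \<sigma> \<tau> \<nu> q) a b p
    = (\<Sum>d\<in>UNIV. frame_comp13 e K S d a d b p)"
proof -
  have "(\<Sum>d\<in>UNIV. frame_comp13 e K S d a d b p) = (\<Sum>d\<in>UNIV. \<Sum>\<tau>\<in>UNIV. \<Sum>\<sigma>\<in>UNIV. \<Sum>\<mu>\<in>UNIV. \<Sum>\<nu>\<in>UNIV.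
      E p $ \<mu> $ d * W p $ d $ \<tau> * (E p $ \<sigma> $ a * E p $ \<nu> $ b * S \<tau> \<sigma> \<mu> \<nu> p))"
    by (simp add: frame_comp13_def coframe_eq_W E_component mult_ac)
  also have "\<dots> = (\<Sum>\<sigma>\<in>UNIV. \<Sum>\<nu>\<in>UNIV. \<Sum>\<tau>\<in>UNIV. \<Sum>\<mu>\<in>UNIV. \<Sum>d\<in>UNIV.
      E p $ \<mu> $ d * W p $ d $ \<tau> * (E p $ \<sigma> $ a * E p $ \<nu> $ b * S \<tau> \<sigma> \<mu> \<nu> p))"
    unfolding sum.cartesian_product
    by (rule sum.reindex_bij_witness[of _ "\<lambda>(\<sigma>, \<nu>, \<tau>, \<mu>, d). (d, \<tau>, \<sigma>, \<mu>, \<nu>)"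
          "\<lambda>(d, \<tau>, \<sigma>, \<mu>, \<nu>). (\<sigma>, \<nu>, \<tau>, \<mu>, d)"]) auto
  also have "\<dots> = (\<Sum>\<sigma>\<in>UNIV. \<Sum>\<nu>\<in>UNIV. \<Sum>\<tau>\<in>UNIV. E p $ \<sigma> $ a * E p $ \<nu> $ b * S \<tau> \<sigma> \<tau> \<nu> p)"
    by (simp only: contract_E_W[OF p] sum_delta_right flip: sum_distrib_right)
  finally show ?thesis
    by (simp add: frame_comp2_def E_component sum_distrib_left)
qed

lemma frame_comp2_ricci:
  assumes p: "p \<in> fst K"
  shows "frame_comp2 e K (ricci g K) a b p = (\<Sum>d\<in>UNIV. curv_hat e \<Gamma> K d a d b p)"
proof -
  have "frame_comp2 e K (ricci g K) a b p
      = frame_comp2 e K (\<lambda>\<sigma> \<nu> q. \<Sum>\<tau>\<in>UNIV. riemann g K \<tau> \<sigma> \<tau> \<nu> q) a b p"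
    by (simp add: frame_comp2_def ricci_def)
  then show ?thesis
    by (simp add: frame_comp2_contract[OF p] frame_comp13_riemann[OF p])
qed

lemma inv_metric_eq:
  assumes p: "p \<in> fst K"
  shows "inv_metric g K \<mu> \<nu> p = (\<Sum>a\<in>UNIV. E p $ \<mu> $ a * (eta a a * E p $ \<nu> $ a))"
proof -
  have "inv_metric g K \<mu> \<nu> p = (E p ** (eta_mat ** transpose (E p))) $ \<mu> $ \<nu>"
    by (simp add: inv_metric_def inv_g[OF p] matrix_mul_assoc)
  then show ?thesis
    by (simp add: matrix_mult_component eta_mat_def transpose_def sum_eta_left)
qed

text \<open>By \<open>inv_metric_eq\<close> the inverse metric is the sum of the squares of the
  frame vectors with signs \<open>eta a a\<close>, so the trace with it is the trace in the
  frame.\<close>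

lemma scalar_curv_eq:
  assumes p: "p \<in> fst K"
  shows "scalar_curv g K p = eta_trace (frame_comp2 e K (ricci g K)) p"
proof -
  have "scalar_curv g K p = (\<Sum>\<mu>\<in>UNIV. \<Sum>\<nu>\<in>UNIV. \<Sum>a\<in>UNIV.
      eta a a * (E p $ \<mu> $ a * E p $ \<nu> $ a * ricci g K \<mu> \<nu> p))"
    by (simp add: scalar_curv_def inv_metric_eq[OF p] sum_distrib_left sum_distrib_right mult_ac)
  also have "\<dots> = (\<Sum>a\<in>UNIV. \<Sum>\<mu>\<in>UNIV. \<Sum>\<nu>\<in>UNIV.
      eta a a * (E p $ \<mu> $ a * E p $ \<nu> $ a * ricci g K \<mu> \<nu> p))"
    unfolding sum.cartesian_product
    by (rule sum.reindex_bij_witness[of _ "\<lambda>(a, \<mu>, \<nu>). (\<mu>, \<nu>, a)" "\<lambda>(\<mu>, \<nu>, a). (a, \<mu>, \<nu>)"]) auto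
  finally show ?thesis
    by (simp add: eta_trace_diag frame_comp2_def E_component sum_distrib_left)
qed

lemma frame_comp2_schouten:
  assumes p: "p \<in> fst K"
  shows "frame_comp2 e K (schouten g K) a b p
    = 1/2 * (frame_comp2 e K (ricci g K) a b p - 1/6 * scalar_curv g K p * eta a b)"
proof -
  have "frame_comp2 e K (schouten g K) a b p = 1/2 * (frame_comp2 e K (ricci g K) a b p
      - 1/6 * scalar_curv g K p * frame_comp2 e K (\<lambda>\<mu> \<nu> p. g K p $ \<mu> $ \<nu>) a b p)"
    by (simp add: frame_comp2_def schouten_def algebra_simps sum_subtractf sum_distrib_left
        sum_divide_distrib)
  then show ?thesis by (simp add: frame_comp2_g[OF p])
qed

section \<open>Frame components of the Weyl tensor\<close>

lemma frame_comp13_diff: "frame_comp13 e K (\<lambda>\<tau> \<sigma> \<mu> \<nu> q. S \<tau> \<sigma> \<mu> \<nu> q - S' \<tau> \<sigma> \<mu> \<nu> q) d a b c p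
    = frame_comp13 e K S d a b c p - frame_comp13 e K S' d a b c p"
  by (simp only: frame_comp13_def right_diff_distrib sum_subtractf)

lemma frame_comp13_swap:
  "frame_comp13 e K (\<lambda>\<tau> \<sigma> \<mu> \<nu>. S \<tau> \<sigma> \<nu> \<mu>) d a b c p = frame_comp13 e K S d a c b p"
proof -
  have "(\<Sum>\<mu>\<in>UNIV. \<Sum>\<nu>\<in>UNIV. coframe e K d \<tau> p * e a K p $ \<sigma> * e b K p $ \<mu> * e c K p $ \<nu> * S \<tau> \<sigma> \<nu> \<mu> p)
    = (\<Sum>\<mu>\<in>UNIV. \<Sum>\<nu>\<in>UNIV. coframe e K d \<tau> p * e a K p $ \<sigma> * e c K p $ \<mu> * e b K p $ \<nu> * S \<tau> \<sigma> \<mu> \<nu> p)"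
    for \<tau> \<sigma>
    by (subst sum.swap) (simp add: mult_ac)
  then show ?thesis by (simp add: frame_comp13_def)
qed

lemma frame_comp13_delta:
  assumes p: "p \<in> fst K"
  shows "frame_comp13 e K (\<lambda>\<tau> \<sigma> \<mu> \<nu> q. delta \<tau> \<mu> * S \<nu> \<sigma> q) d a b c p
    = delta d b * frame_comp2 e K S c a p"
proof -
  have "frame_comp13 e K (\<lambda>\<tau> \<sigma> \<mu> \<nu> q. delta \<tau> \<mu> * S \<nu> \<sigma> q) d a b c p
    = (\<Sum>\<tau>\<in>UNIV. \<Sum>\<sigma>\<in>UNIV. \<Sum>\<mu>\<in>UNIV. delta \<tau> \<mu> * (\<Sum>\<nu>\<in>UNIV. W p $ d $ \<tau> * E p $ \<mu> $ b * (E p $ \<nu> $ c * E p $ \<sigma> $ a * S \<nu> \<sigma> p)))"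
    by (simp add: frame_comp13_def coframe_eq_W E_component sum_distrib_left mult_ac)
  also have "\<dots> = (\<Sum>\<tau>\<in>UNIV. \<Sum>\<sigma>\<in>UNIV. \<Sum>\<nu>\<in>UNIV. W p $ d $ \<tau> * E p $ \<tau> $ b * (E p $ \<nu> $ c * E p $ \<sigma> $ a * S \<nu> \<sigma> p))"
    by (simp only: sum_delta_left)
  also have "\<dots> = delta d b * (\<Sum>\<sigma>\<in>UNIV. \<Sum>\<nu>\<in>UNIV. E p $ \<nu> $ c * E p $ \<sigma> $ a * S \<nu> \<sigma> p)"
    by (simp only: contract_W_E[OF p] flip: sum_distrib_left sum_distrib_right)
  finally show ?thesis
    by (simp add: frame_comp2_def E_component) (intro disjI2 sum.swap)
qed

lemma frame_comp13_g:
  assumes p: "p \<in> fst K"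
  shows "frame_comp13 e K (\<lambda>\<tau> \<sigma> \<mu> \<nu> q. g K q $ \<sigma> $ \<mu> * schouten_up g K \<nu> \<tau> q) d a b c p
    = eta a b * raise2 (frame_comp2 e K (schouten g K)) c d p"
proof -
  \<comment> \<open>Raising an index with the inverse metric and then contracting with the coframe
    amounts to contracting with the frame and raising with eta.\<close>
  have up: "(\<Sum>\<tau>\<in>UNIV. W p $ d $ \<tau> * schouten_up g K \<nu> \<tau> p)
      = eta d d * (\<Sum>\<sigma>\<in>UNIV. E p $ \<sigma> $ d * schouten g K \<nu> \<sigma> p)" for \<nu>
  proof -
    have "(\<Sum>\<tau>\<in>UNIV. W p $ d $ \<tau> * schouten_up g K \<nu> \<tau> p)
      = (\<Sum>\<tau>\<in>UNIV. \<Sum>\<sigma>\<in>UNIV. \<Sum>f\<in>UNIV. W p $ d $ \<tau> * E p $ \<tau> $ f * (eta f f * E p $ \<sigma> $ f * schouten g K \<nu> \<sigma> p))"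
      by (simp add: schouten_up_def inv_metric_eq[OF p] sum_distrib_left mult_ac)
    also have "\<dots> = (\<Sum>\<sigma>\<in>UNIV. \<Sum>f\<in>UNIV. \<Sum>\<tau>\<in>UNIV. W p $ d $ \<tau> * E p $ \<tau> $ f * (eta f f * E p $ \<sigma> $ f * schouten g K \<nu> \<sigma> p))"
      by (subst sum.swap) (intro sum.cong refl sum.swap)
    also have "\<dots> = (\<Sum>\<sigma>\<in>UNIV. eta d d * E p $ \<sigma> $ d * schouten g K \<nu> \<sigma> p)"
      by (simp only: contract_W_E[OF p] sum_delta_left flip: sum_distrib_right)
    finally show ?thesis by (simp add: sum_distrib_left mult_ac)
  qed
  have "frame_comp13 e K (\<lambda>\<tau> \<sigma> \<mu> \<nu> q. g K q $ \<sigma> $ \<mu> * schouten_up g K \<nu> \<tau> q) d a b c p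
    = (\<Sum>\<tau>\<in>UNIV. \<Sum>\<sigma>\<in>UNIV. \<Sum>\<mu>\<in>UNIV. \<Sum>\<nu>\<in>UNIV. (E p $ \<sigma> $ a * E p $ \<mu> $ b * g K p $ \<sigma> $ \<mu>)
        * (E p $ \<nu> $ c * (W p $ d $ \<tau> * schouten_up g K \<nu> \<tau> p)))"
    by (simp add: frame_comp13_def coframe_eq_W E_component mult_ac)
  also have "\<dots> = (\<Sum>\<sigma>\<in>UNIV. \<Sum>\<mu>\<in>UNIV. \<Sum>\<nu>\<in>UNIV. \<Sum>\<tau>\<in>UNIV. (E p $ \<sigma> $ a * E p $ \<mu> $ b * g K p $ \<sigma> $ \<mu>)
        * (E p $ \<nu> $ c * (W p $ d $ \<tau> * schouten_up g K \<nu> \<tau> p)))"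
    unfolding sum.cartesian_product
    by (rule sum.reindex_bij_witness[of _ "\<lambda>(\<sigma>, \<mu>, \<nu>, \<tau>). (\<tau>, \<sigma>, \<mu>, \<nu>)" "\<lambda>(\<tau>, \<sigma>, \<mu>, \<nu>). (\<sigma>, \<mu>, \<nu>, \<tau>)"])
      auto
  also have "\<dots> = frame_comp2 e K (\<lambda>\<mu> \<nu> p. g K p $ \<mu> $ \<nu>) a b p *
      (\<Sum>\<nu>\<in>UNIV. E p $ \<nu> $ c * (eta d d * (\<Sum>\<sigma>\<in>UNIV. E p $ \<sigma> $ d * schouten g K \<nu> \<sigma> p)))"
    by (simp only: up frame_comp2_def E_component flip: sum_distrib_left sum_distrib_right)
  also have "(\<Sum>\<nu>\<in>UNIV. E p $ \<nu> $ c * (eta d d * (\<Sum>\<sigma>\<in>UNIV. E p $ \<sigma> $ d * schouten g K \<nu> \<sigma> p)))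
      = raise2 (frame_comp2 e K (schouten g K)) c d p"
    by (simp add: raise2_diag frame_comp2_def E_component sum_distrib_left mult_ac)
  finally show ?thesis by (simp add: frame_comp2_g[OF p])
qed

text \<open>In the frame, the Schouten part of the decomposition has the shape of
  \<open>rho_curv\<close> with its Weyl slot set to zero.\<close>

lemma frame_comp13_weyl:
  assumes p: "p \<in> fst K"
  shows "frame_comp13 e K (weyl g K) d a b c p
    = curv_hat e \<Gamma> K d a b c p - rho_curv (frame_comp2 e K (schouten g K)) (\<lambda>_ _ _ _ _. 0) d a b c p"
proof -
  \<comment> \<open>The antisymmetrisations are split into single products, to which the frame
    formulas apply; \<open>frame_comp13_swap\<close> covers those with \<mu> and \<nu>
    exchanged.\<close>
  define A1 where "A1 \<tau> \<sigma> \<mu> \<nu> q = delta \<tau> \<mu> * schouten g K \<nu> \<sigma> q" for \<tau> \<sigma> \<mu> \<nu> q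
  define A2 where "A2 \<tau> \<sigma> \<mu> \<nu> q = g K q $ \<sigma> $ \<mu> * schouten_up g K \<nu> \<tau> q" for \<tau> \<sigma> \<mu> \<nu> q
  have weyl: "weyl g K = (\<lambda>\<tau> \<sigma> \<mu> \<nu> q. riemann g K \<tau> \<sigma> \<mu> \<nu> q
      - ((A1 \<tau> \<sigma> \<mu> \<nu> q - A1 \<tau> \<sigma> \<nu> \<mu> q) - (A2 \<tau> \<sigma> \<mu> \<nu> q - A2 \<tau> \<sigma> \<nu> \<mu> q)))"
    by (intro ext) (simp add: weyl_def right_diff_distrib twice_asym A1_def A2_def)
  have A1: "frame_comp13 e K A1 d a b c p = delta d b * frame_comp2 e K (schouten g K) c a p" for b c
    using frame_comp13_delta[OF p, of "schouten g K"] by (simp add: A1_def[abs_def])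
  have A2: "frame_comp13 e K A2 d a b c p
      = eta a b * raise2 (frame_comp2 e K (schouten g K)) c d p" for b c
    using frame_comp13_g[OF p] by (simp add: A2_def[abs_def])
  show ?thesis
    unfolding weyl frame_comp13_diff frame_comp13_swap[of A1] frame_comp13_swap[of A2] A1 A2
      frame_comp13_riemann[OF p]
    unfolding rho_curv_def twice_asym by simp
qed

end

section \<open>The metric of the coframe\<close>

lemma coordinate_chart_if_smooth_manifold4:
  assumes "smooth_manifold4 X A" "K \<in> A"
  shows "coordinate_chart K"
proof -
  have K: "openin X (fst K)" "open (snd K ` fst K)"
    "homeomorphic_map (subtopology X (fst K)) (top_of_set (snd K ` fst K)) (snd K)"
    using assms unfolding smooth_manifold4_def by (auto simp: case_prod_beta)
  have "topspace (subtopology X (fst K)) = fst K"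
    using openin_subset[OF K(1)] by auto
  then have "inj_on (snd K) (fst K)"
    using homeomorphic_imp_injective_map[OF K(3)] by simp
  with K(2) show ?thesis by unfold_locales
qed

text \<open>
  The transformation law of the frame vectors already yields \<open>E = J E'\<close> and \<open>W' = W J\<close> for the Jacobian
  \<open>J\<close>, so no chain rule for the coordinate change is needed.
\<close>

lemma coframe_metric_transform:
  assumes "framed_chart K e \<Gamma>" "framed_chart K' e \<Gamma>" "\<And>a. vector_field A (e a)"
    and "K \<in> A" "K' \<in> A" "p \<in> fst K \<inter> fst K'"
  shows "coframe_metric e K' p $ \<mu> $ \<nu> =
    (\<Sum>\<alpha>\<in>UNIV. \<Sum>\<beta>\<in>UNIV. coord_deriv K' \<mu> (\<lambda>q. snd K q $ \<alpha>) p *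
       coord_deriv K' \<nu> (\<lambda>q. snd K q $ \<beta>) p * coframe_metric e K p $ \<alpha> $ \<beta>)"
proof -
  interpret K: framed_chart K e \<Gamma> by fact
  interpret K': framed_chart K' e \<Gamma> by fact
  have p: "p \<in> fst K" "p \<in> fst K'" using assms by auto
  define J where "J = (\<chi> \<alpha> \<mu>. coord_deriv K' \<mu> (\<lambda>q. snd K q $ \<alpha>) p)"
  have "e a K p $ \<alpha> = (\<Sum>\<mu>\<in>UNIV. coord_deriv K' \<mu> (\<lambda>q. snd K q $ \<alpha>) p * e a K' p $ \<mu>)" for a \<alpha>
    using assms(3)[of a] assms(4-6) unfolding vector_field_def by blast
  then have E: "K.E p = J ** K'.E p"
    by (simp only: vec_eq_iff K.E_def K'.E_def J_def matrix_mult_component vec_lambda_beta) simp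
  have "K'.W p = K.W p ** K.E p ** K'.W p"
    by (simp add: K.W_E[OF p(1)])
  also have "\<dots> = K.W p ** J"
    by (simp add: E K'.cancel_E_W[OF p(2)] matrix_mul_assoc)
  finally have "coframe_metric e K' p = transpose J ** coframe_metric e K p ** J"
    by (simp add: K.g_eq K'.g_eq matrix_transpose_mul matrix_mul_assoc)
  then show ?thesis
    by (subst sum.swap)
      (simp add: J_def matrix_mult_component transpose_def sum_distrib_left sum_distrib_right mult_ac)
qed

lemma lorentzian_coframe_metric:
  assumes framed: "\<And>K. K \<in> A \<Longrightarrow> framed_chart K e \<Gamma>" and "\<And>a. vector_field A (e a)"
  shows "lorentzian_metric A (coframe_metric e)"
  unfolding lorentzian_metric_def
proof (intro conjI ballI allI)
  fix K \<mu> \<nu>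
  assume "K \<in> A"
  then interpret framed_chart K e \<Gamma> by (rule framed)
  show "smooth_in K (\<lambda>p. g K p $ \<mu> $ \<nu>)"
    by (rule smooth_mat_component[OF smooth_g])
next
  fix K p
  assume "K \<in> A" and p: "p \<in> fst K"
  from framed[OF this(1)] interpret framed_chart K e \<Gamma> .
  show "transpose (g K p) = g K p" by (rule transpose_g)
  \<comment> \<open>The frame matrix itself serves as \<open>P\<close>.\<close>
  show "\<exists>P. invertible P \<and> transpose P ** g K p ** P = (\<chi> a b. eta a b)"
    using invertible_E[OF p] frame_orthonormal[OF p] by (auto simp: eta_mat_def)
next
  fix K K' p \<mu> \<nu>
  assume K: "K \<in> A" and K': "K' \<in> A" and p: "p \<in> fst K \<inter> fst K'"
  show "coframe_metric e K' p $ \<mu> $ \<nu> =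
    (\<Sum>\<alpha>\<in>UNIV. \<Sum>\<beta>\<in>UNIV. coord_deriv K' \<mu> (\<lambda>q. snd K q $ \<alpha>) p *
       coord_deriv K' \<nu> (\<lambda>q. snd K q $ \<beta>) p * coframe_metric e K p $ \<alpha> $ \<beta>)"
    by (rule coframe_metric_transform[OF framed[OF K] framed[OF K'] assms(2) K K' p])
qed

section \<open>Einstein's equations\<close>

context framed_chart
begin

text \<open>Contracting \<open>curv\<close> gives Einstein's equations in trace-reversed form.
  Together with their trace they determine both combinations of Ricci tensor and scalar
  curvature.\<close>

lemma schouten_and_einstein:
  assumes p: "p \<in> fst K" and T: "\<And>a b. T a b p = T b a p" and C: "weyl_symmetries C p"
    and curv: "\<And>d a b c. curv_hat e \<Gamma> K d a b c p = rho_curv (L_hat \<kappa> T) C d a b c p"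
  shows "frame_comp2 e K (ricci g K) a b p - 1/2 * eta a b * scalar_curv g K p = \<kappa> * T a b p"
    and "frame_comp2 e K (schouten g K) a b p = L_hat \<kappa> T a b p"
proof -
  have ric: "frame_comp2 e K (ricci g K) a b p = \<kappa> * (T a b p - 1/2 * eta a b * eta_trace T p)" for a b
  proof -
    have "frame_comp2 e K (ricci g K) a b p
        = 2 * L_hat \<kappa> T a b p + eta a b * eta_trace (L_hat \<kappa> T) p"
      unfolding frame_comp2_ricci[OF p] curv
      by (rule rho_curv_contract) (use T C in \<open>auto simp: L_hat_def eta_commute weyl_symmetries_def\<close>)
    then show ?thesis
      unfolding eta_trace_L_hat by (simp add: L_hat_def algebra_simps)
  qed
  \<comment> \<open>The trace of the previous equation: T minus half of 4 T, times \<kappa>.\<close>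
  have scal: "scalar_curv g K p = - \<kappa> * eta_trace T p"
  proof -
    have "eta a a * frame_comp2 e K (ricci g K) a a p
        = \<kappa> * (eta a a * T a a p) - \<kappa> / 2 * (eta a a * eta a a) * eta_trace T p" for a
      unfolding ric by (simp add: algebra_simps)
    then have "scalar_curv g K p
        = \<kappa> * (\<Sum>a\<in>UNIV. eta a a * T a a p) - 4 * (\<kappa> / 2 * eta_trace T p)"
      unfolding scalar_curv_eq[OF p] eta_trace_diag[of "frame_comp2 e K (ricci g K)"]
        eta_diag_square sum_distrib_left[of \<kappa>]
      by (simp add: sum_subtractf)
    then show ?thesis
      unfolding eta_trace_diag[of T, symmetric] by simp
  qed
  show "frame_comp2 e K (ricci g K) a b p - 1/2 * eta a b * scalar_curv g K p = \<kappa> * T a b p"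
    unfolding ric scal by (simp add: algebra_simps)
  show "frame_comp2 e K (schouten g K) a b p = L_hat \<kappa> T a b p"
    unfolding frame_comp2_schouten[OF p] ric scal by (simp add: L_hat_def algebra_simps)
qed

text \<open>Once \<open>L\<close> is the Schouten tensor, its terms in \<open>rho_curv\<close> are
  exactly those subtracted from the Riemann tensor, and \<open>C\<close> is left over.\<close>

lemma weyl_of_curvature:
  assumes p: "p \<in> fst K"
    and S: "\<And>a b. frame_comp2 e K (schouten g K) a b p = L a b p"
    and curv: "\<And>d a b c. curv_hat e \<Gamma> K d a b c p = rho_curv L C d a b c p"
  shows "frame_comp13 e K (weyl g K) d a b c p = C d a b c p"
  unfolding frame_comp13_weyl[OF p] curv
  by (simp add: rho_curv_def twice_asym raise2_diag S)

end

theorem lemma1: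
  fixes X :: "'m topology"
    and A :: "'m chart set"
    and e :: "'m frame"
    and \<Gamma> :: "'m conn"
    and \<rho> :: "'m \<Rightarrow> real"
    and P T L :: "4 \<Rightarrow> 4 \<Rightarrow> 'm \<Rightarrow> real"
    and C :: "4 \<Rightarrow> 4 \<Rightarrow> 4 \<Rightarrow> 4 \<Rightarrow> 'm \<Rightarrow> real"
    and \<kappa> :: real
  assumes "smooth_manifold4 X A"
    and "is_frame A e"
    and "\<And>a b c. smooth_scalar A (\<Gamma> a b c)"
    and "smooth_scalar A \<rho>"
    and "\<And>a b. smooth_scalar A (P a b)"
    and "\<And>a b c d. smooth_scalar A (C d a b c)"
    and "\<And>p. p \<in> topspace X \<Longrightarrow> \<rho> p > 0"
    and "\<And>a b p. p \<in> topspace X \<Longrightarrow> P a b p = P b a p"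
    and "\<And>b p. p \<in> topspace X \<Longrightarrow> (\<Sum>a\<in>UNIV. P a b p * u_up a) = 0"
    and "T = emt \<rho> P"
    and "L = L_hat \<kappa> T"
    and "\<And>p. p \<in> topspace X \<Longrightarrow> weyl_symmetries C p"
    and "\<And>p. p \<in> topspace X \<Longrightarrow> metric_compatible \<Gamma> p"
    and "\<And>K b p. K \<in> A \<Longrightarrow> p \<in> fst K \<Longrightarrow> div_emt e \<Gamma> T K b p = 0"
    and "\<And>K a c b p. K \<in> A \<Longrightarrow> p \<in> fst K \<Longrightarrow> torsion e \<Gamma> K a c b p = 0"
    and "\<And>K d a b c p. K \<in> A \<Longrightarrow> p \<in> fst K \<Longrightarrow> Delta_zero e \<Gamma> L C K d a b c p = 0"
    and "\<And>K b c d p. K \<in> A \<Longrightarrow> p \<in> fst K \<Longrightarrow> F_zero e \<Gamma> L C K b c d p = 0"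
  shows "\<exists>g. lorentzian_metric A g \<and>
    (\<forall>K\<in>A. \<forall>p \<in> fst K.
       g K p = coframe_metric e K p \<and>
       (\<forall>a b. frame_comp2 e K (\<lambda>\<mu> \<nu> p. g K p $ \<mu> $ \<nu>) a b p = eta a b) \<and>
       (\<forall>a b. frame_comp2 e K (ricci g K) a b p - 1/2 * eta a b * scalar_curv g K p
              = \<kappa> * T a b p) \<and>
       (\<forall>d a b c. frame_comp13 e K (weyl g K) d a b c p = C d a b c p))"
proof -
  have topspace: "p \<in> topspace X" if "K \<in> A" "p \<in> fst K" for K p
    using assms(1) that unfolding smooth_manifold4_def by blast
  have vector: "vector_field A (e a)" for a
    using assms(2) by (simp add: is_frame_def)
  have framed: "framed_chart K e \<Gamma>" if K: "K \<in> A" for K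
  proof -
    interpret coordinate_chart K
      using coordinate_chart_if_smooth_manifold4[OF assms(1) K] .
    show ?thesis
    proof
      show "smooth_in K (\<lambda>p. e a K p $ \<mu>)" for a \<mu>
        using vector[of a] K by (auto simp: vector_field_def)
      show "smooth_in K (\<Gamma> a c b)" for a b c
        using assms(3) K by (simp add: smooth_scalar_def)
    qed (use assms(2,13,15) topspace K in \<open>auto simp: is_frame_def\<close>)
  qed
  have solution: "(\<forall>a b. frame_comp2 e K (\<lambda>\<mu> \<nu> p. coframe_metric e K p $ \<mu> $ \<nu>) a b p = eta a b) \<and>
       (\<forall>a b. frame_comp2 e K (ricci (coframe_metric e) K) a b p
          - 1/2 * eta a b * scalar_curv (coframe_metric e) K p = \<kappa> * T a b p) \<and>
       (\<forall>d a b c. frame_comp13 e K (weyl (coframe_metric e) K) d a b c p = C d a b c p)"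
    if K: "K \<in> A" and p: "p \<in> fst K" for K p
  proof -
    interpret framed_chart K e \<Gamma> by (rule framed[OF K])
    have T: "T a b p = T b a p" for a b
      using assms(8)[OF topspace[OF K p], of a b] by (simp add: assms(10) emt_def)
    have curv: "curv_hat e \<Gamma> K d a b c p = rho_curv (L_hat \<kappa> T) C d a b c p" for d a b c
      using assms(16)[OF K p, of d a b c] by (simp add: assms(11) Delta_zero_def)
    \<comment> \<open>The second fact identifies \<open>L_hat \<kappa> T\<close> with the Schouten
      tensor of the metric, as \<open>weyl_of_curvature\<close> requires.\<close>
    note einstein = schouten_and_einstein[OF p T assms(12)[OF topspace[OF K p]] curv]
    show ?thesis
      using frame_comp2_g[OF p] einstein(1) weyl_of_curvature[OF p einstein(2) curv] by blast
  qed
  show ?thesis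
    using lorentzian_coframe_metric[OF framed vector] solution
    by (intro exI[of _ "coframe_metric e"]) blast
qed

end
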